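(* Let $A\in\mathbb R^{n\times n}$, $B_u\in\mathbb R^{n\times n_u}$ and let $Q_{\min},Q_{\max}\in\mathbb R^{n\times n}$, $R_{\min},R_{\max}\in\mathbb R^{n_u\times n_u}$ be positive definite, with $(A,B_u)$ stabilizable. There exist constants $\alpha_1,\alpha_2$ depending only on $R_{\min},R_{\max},Q_{\min},Q_{\max},A,B_u$ (in particular not on $W$) such that, for every horizon $T$, every prediction window $W$, every $B_d$, initial state $x_1$, cost matrices $(Q_t)_{t=1}^{T}$, $(R_t)_{t=1}^{T-1}$ satisfying the standing assumptions in the context, disturbances $(d_t)$ and predictions $(d_{i|t})$, the dynamic regret of the MPC algorithm satisfies $$\mathrm{Regret}(\mathrm{MPC})\le \alpha_1\left[\frac{1}{1-\rho}(\gamma^W+\rho^W)+\gamma\frac{\rho^W-\gamma^W}{\rho-\gamma}\right]^2\left(\|x_1\|^2+\sum_{t=1}^{T}\|B_dd_t\|^2\right)$$ $$\qquad+\ \alpha_2\left(\frac{1}{1-\rho}+\frac{\gamma^W}{1-\rho^2}\right)\left(1+\frac{\gamma^W}{1-\rho}\right)\sum_{j=1}^{T-1}\sum_{i=j}^{j+W}\rho^{i-j}\|B_de_{i|j}\|^2 .$$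
   Context: Norms are Euclidean (vectors) and spectral (matrices); $0^0=1$. System: $x_{t+1}=Ax_t+B_uu_t+B_dd_t$ for $1\le t\le T-1$, with $x_1\in\mathbb R^n$ fixed, $u_t\in\mathbb R^{n_u}$, $d_t\in\mathbb R^{n_d}$, $B_d\in\mathbb R^{n\times n_d}$. Cost: $J(\mathbf x,\mathbf u)=\sum_{t=1}^{T-1}(x_t^\top Q_tx_t+u_t^\top R_tu_t)+x_T^\top Q_Tx_T$ with symmetric $Q_t,R_t$. Standing assumptions: $(A,B_u)$ is stabilizable and all $(A,Q_t)$ are detectable; $0\prec Q_{\min}\preceq Q_t\preceq Q_{\max}$ for $1\le t\le T$ and $0\prec R_{\min}\preceq R_t\preceq R_{\max}$ for $1\le t\le T-1$. Let $F_{Q,R}(P)=Q+A^\top PA-A^\top PB_u(R+B_u^\top PB_u)^{-1}B_u^\top PA$. Let $P_T=Q_T$, $P_t=F_{Q_t,R_t}(P_{t+1})$ and $K_t=(R_t+B_u^\top P_{t+1}B_u)^{-1}B_u^\top P_{t+1}A$ for $1\le t\le T-1$. Let $\Phi(t,t_0)=(A-B_uK_{t-1})\cdots(A-B_uK_{t_0})$ for $t>t_0$, $\Phi(t,t)=I$, and $K_t^{d,i}=(R_t+B_u^\top P_{t+1}B_u)^{-1}B_u^\top\Phi(i+1,t+1)^\top P_{i+1}$ for $t\le i\le T-1$. $P_{\max}$ is the (positive definite) solution of $P_{\max}=F_{Q_{\max},R_{\max}}(P_{\max})$. Set $$\rho=\sqrt{1-\frac{\lambda_{\min}(Q_{\min})}{\lambda_{\max}(P_{\max})}},\qquad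 \gamma=\frac{\lambda_{\max}(A^\top P_{\max}A)}{\lambda_{\min}(Q_{\min})+\lambda_{\max}(A^\top P_{\max}A)}.$$ If $\rho=\gamma$, $\gamma\frac{\rho^W-\gamma^W}{\rho-\gamma}$ is read as $\sum_{i=0}^{W-1}\gamma^{W-i}\rho^i$. Predictions: at each time $t$ the controller receives $d_{i|t}$ (predictions of $d_i$) and the exact $Q_i,R_i$ for $t\le i\le t+W$; $e_{i|t}=d_{i|t}-d_i$. Only indices $i\le T-1$ matter: terms with $i>T-1$ in sums involving $d_{i|t}$ or $e_{i|t}$ are omitted. MPC algorithm: $u_t^{\mathrm{MPC}}=-\bar K_tx_t^{\mathrm{MPC}}-\sum_{i=t}^{\min\{t+W,T-1\}}\bar K_t^{d,i}B_dd_{i|t}$, where: (i) if $t\le T-W-1$: $\bar P_{t+W+1|t}=P_{\max}$, $\bar P_{i|t}=F_{Q_i,R_i}(\bar P_{i+1|t})$ and $\bar K_{i|t}=(R_i+B_u^\top\bar P_{i+1|t}B_u)^{-1}B_u^\top\bar P_{i+1|t}A$ for $t\le i\le t+W$; $\bar\Phi_t(t+j,t+i)=(A-B_u\bar K_{t+j-1|t})\cdots(A-B_u\bar K_{t+i|t})$ for $0\le i<j\le W+1$ and $I$ for $i=j$; $\bar K_t=\bar K_{t|t}$, and $\bar K_t^{d,i}=(R_t+B_u^\top\bar P_{t+1|t}B_u)^{-1}B_u^\top\bar\Phi_t(i+1,t+1)^\top\bar P_{i+1|t}$ for $t\le i\le t+W$; (ii) if $T-W\le t\le T-1$: $\bar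 K_t=K_t$ and $\bar K_t^{d,i}=K_t^{d,i}$ for $t\le i\le T-1$. The trajectory $(x_t^{\mathrm{MPC}},u_t^{\mathrm{MPC}})$ starts at $x_1$ and evolves under the true disturbances $d_t$. The dynamic regret is $\mathrm{Regret}(\mathrm{MPC})=J(\mathbf x^{\mathrm{MPC}},\mathbf u^{\mathrm{MPC}})-J^*$, where $J^*$ is the minimum of $J$ over all control sequences, for the true costs and disturbances known in hindsight. *)

theory Defs
  imports "HOL-Analysis.Analysis"
begin

definition is_eigenval :: "('a::field)^'n^'n \<Rightarrow> 'a \<Rightarrow> bool" where
  "is_eigenval M l \<longleftrightarrow> (\<exists>v. v \<noteq> 0 \<and> M *v v = l *s v)"

text \<open>The next two are only meant for symmetric real matrices, whose set of real eigenvalues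
  is finite and nonempty.\<close>

definition lambda_min :: "real^'n^'n \<Rightarrow> real" where
  "lambda_min M = Min {l. is_eigenval M l}"

definition lambda_max :: "real^'n^'n \<Rightarrow> real" where
  "lambda_max M = Max {l. is_eigenval M l}"

definition sym_mat :: "real^'n^'n \<Rightarrow> bool" where
  "sym_mat M \<longleftrightarrow> transpose M = M"

definition pos_def :: "real^'n^'n \<Rightarrow> bool" where
  "pos_def M \<longleftrightarrow> sym_mat M \<and> (\<forall>x. x \<noteq> 0 \<longrightarrow> x \<bullet> (M *v x) > 0)"

definition loewner_le :: "real^'n^'n \<Rightarrow> real^'n^'n \<Rightarrow> bool" where
  "loewner_le M N \<longleftrightarrow> sym_mat (N - M) \<and> (\<forall>x. x \<bullet> ((N - M) *v x) \<ge> 0)"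

text \<open>Schur stability refers to all complex eigenvalues of the real matrix.\<close>

definition schur_stable :: "real^'n^'n \<Rightarrow> bool" where
  "schur_stable M \<longleftrightarrow> (\<forall>l. is_eigenval (map_matrix complex_of_real M) l \<longrightarrow> cmod l < 1)"

definition stabilizable :: "real^'n^'n \<Rightarrow> real^'u^'n \<Rightarrow> bool" where
  "stabilizable A B \<longleftrightarrow> (\<exists>K. schur_stable (A - B ** K))"

definition detectable :: "real^'n^'n \<Rightarrow> real^'n^'m \<Rightarrow> bool" where
  "detectable A C \<longleftrightarrow> (\<exists>L. schur_stable (A - L ** C))"

text \<open>A disturbance matrix with \<open>nd\<close> columns \<open>Bd 0, \<dots>, Bd (nd - 1)\<close> applied to a vector with
  entries \<open>v 0, \<dots>, v (nd - 1)\<close>. The number of columns is a natural number rather than a type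
  so that it can be quantified after the constants of a bound, which must not depend on it.\<close>

definition dist_mult :: "nat \<Rightarrow> (nat \<Rightarrow> real^'n) \<Rightarrow> (nat \<Rightarrow> real) \<Rightarrow> real^'n" where
  "dist_mult nd Bd v = (\<Sum>k<nd. v k *\<^sub>R Bd k)"

definition riccati_F ::
  "real^'n^'n \<Rightarrow> real^'u^'n \<Rightarrow> real^'n^'n \<Rightarrow> real^'u^'u \<Rightarrow> real^'n^'n \<Rightarrow> real^'n^'n" where
  "riccati_F A B Q R P =
     Q + transpose A ** P ** A
       - transpose A ** P ** B ** matrix_inv (R + transpose B ** P ** B) ** transpose B ** P ** A"

definition dare_sol ::
  "real^'n^'n \<Rightarrow> real^'u^'n \<Rightarrow> real^'n^'n \<Rightarrow> real^'u^'u \<Rightarrow> real^'n^'n" where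
  "dare_sol A B Q R = (THE P. pos_def P \<and> P = riccati_F A B Q R P)"

text \<open>The backward Riccati recursion with value \<open>S\<close> at time \<open>e\<close>, evaluated at time \<open>t \<le> e\<close>.\<close>

function riccati_rec ::
  "real^'n^'n \<Rightarrow> real^'u^'n \<Rightarrow> (nat \<Rightarrow> real^'n^'n) \<Rightarrow> (nat \<Rightarrow> real^'u^'u) \<Rightarrow>
   real^'n^'n \<Rightarrow> nat \<Rightarrow> nat \<Rightarrow> real^'n^'n" where
  "riccati_rec A B Q R S e t =
     (if e \<le> t then S else riccati_F A B (Q t) (R t) (riccati_rec A B Q R S e (Suc t)))"
  by pat_completeness auto
termination
  by (relation "Wellfounded.measure (\<lambda>(A, B, Q, R, S, e, t). e - t)") auto

declare riccati_rec.simps [simp del]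

text \<open>In \<open>gain\<close> and \<open>dist_gain\<close>, \<open>P\<close> is a sequence of Riccati matrices indexed by time.
  \<open>transition A B K t s\<close> is \<open>(A - B K\<^sub>t\<^sub>-\<^sub>1) \<cdots> (A - B K\<^sub>s)\<close> for \<open>t > s\<close>, and the identity
  for \<open>t = s\<close>.\<close>

definition gain ::
  "real^'n^'n \<Rightarrow> real^'u^'n \<Rightarrow> (nat \<Rightarrow> real^'u^'u) \<Rightarrow> (nat \<Rightarrow> real^'n^'n) \<Rightarrow> nat \<Rightarrow> real^'n^'u" where
  "gain A B R P t =
     matrix_inv (R t + transpose B ** P (t + 1) ** B) ** transpose B ** P (t + 1) ** A"

fun transition ::
  "real^'n^'n \<Rightarrow> real^'u^'n \<Rightarrow> (nat \<Rightarrow> real^'n^'u) \<Rightarrow> nat \<Rightarrow> nat \<Rightarrow> real^'n^'n" where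
  "transition A B K 0 s = mat 1"
| "transition A B K (Suc t) s =
     (if s \<le> t then (A - B ** K t) ** transition A B K t s else mat 1)"

definition dist_gain ::
  "real^'n^'n \<Rightarrow> real^'u^'n \<Rightarrow> (nat \<Rightarrow> real^'u^'u) \<Rightarrow> (nat \<Rightarrow> real^'n^'n) \<Rightarrow> nat \<Rightarrow> nat \<Rightarrow> real^'n^'u"
  where
  "dist_gain A B R P t i =
     matrix_inv (R t + transpose B ** P (t + 1) ** B) ** transpose B
       ** transpose (transition A B (gain A B R P) (i + 1) (t + 1)) ** P (i + 1)"

text \<open>Time starts at \<open>1\<close>, so \<open>traj\<close> and \<open>mpc_state\<close> below have a meaningless value at \<open>0\<close>.
  The sequence \<open>w\<close> is the disturbance \<open>w t = B\<^sub>d d\<^sub>t\<close> as it enters the state equation, and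
  \<open>wp t i = B\<^sub>d d\<^sub>i\<^sub>|\<^sub>t\<close> is the prediction of \<open>w i\<close> made at time \<open>t\<close>.\<close>

fun traj ::
  "real^'n^'n \<Rightarrow> real^'u^'n \<Rightarrow> (nat \<Rightarrow> real^'n) \<Rightarrow> real^'n \<Rightarrow> (nat \<Rightarrow> real^'u) \<Rightarrow> nat \<Rightarrow> real^'n" where
  "traj A B w x1 u 0 = x1"
| "traj A B w x1 u (Suc t) =
     (if t = 0 then x1 else A *v traj A B w x1 u t + B *v u t + w t)"

definition cost ::
  "nat \<Rightarrow> (nat \<Rightarrow> real^'n^'n) \<Rightarrow> (nat \<Rightarrow> real^'u^'u) \<Rightarrow> (nat \<Rightarrow> real^'n) \<Rightarrow> (nat \<Rightarrow> real^'u) \<Rightarrow> real"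
  where
  "cost T Q R x u =
     (\<Sum>t\<in>{1..<T}. x t \<bullet> (Q t *v x t) + u t \<bullet> (R t *v u t)) + x T \<bullet> (Q T *v x T)"

text \<open>For positive definite costs the infimum is over a set bounded below by \<open>0\<close> and is attained,
  so it is the minimum.\<close>

definition opt_cost ::
  "real^'n^'n \<Rightarrow> real^'u^'n \<Rightarrow> nat \<Rightarrow> (nat \<Rightarrow> real^'n^'n) \<Rightarrow> (nat \<Rightarrow> real^'u^'u) \<Rightarrow>
   (nat \<Rightarrow> real^'n) \<Rightarrow> real^'n \<Rightarrow> real" where
  "opt_cost A B T Q R w x1 = (INF u. cost T Q R (traj A B w x1 u) u)"

text \<open>The Riccati matrices used at time \<open>t\<close>: as long as the window ends before \<open>T\<close>, the recursion
  is started from \<open>Pm\<close> at time \<open>t + W + 1\<close>; afterwards the full-horizon sequence is used.\<close>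

definition mpc_P ::
  "real^'n^'n \<Rightarrow> real^'u^'n \<Rightarrow> real^'n^'n \<Rightarrow> nat \<Rightarrow> nat \<Rightarrow>
   (nat \<Rightarrow> real^'n^'n) \<Rightarrow> (nat \<Rightarrow> real^'u^'u) \<Rightarrow> nat \<Rightarrow> nat \<Rightarrow> real^'n^'n" where
  "mpc_P A B Pm T W Q R t =
     (if t + W + 1 \<le> T then riccati_rec A B Q R Pm (t + W + 1)
      else riccati_rec A B Q R (Q T) T)"

definition mpc_control ::
  "real^'n^'n \<Rightarrow> real^'u^'n \<Rightarrow> real^'n^'n \<Rightarrow> nat \<Rightarrow> nat \<Rightarrow>
   (nat \<Rightarrow> real^'n^'n) \<Rightarrow> (nat \<Rightarrow> real^'u^'u) \<Rightarrow> (nat \<Rightarrow> nat \<Rightarrow> real^'n) \<Rightarrow>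
   nat \<Rightarrow> real^'n \<Rightarrow> real^'u" where
  "mpc_control A B Pm T W Q R wp t x =
     - (gain A B R (mpc_P A B Pm T W Q R t) t *v x)
     - (\<Sum>i = t..min (t + W) (T - 1). dist_gain A B R (mpc_P A B Pm T W Q R t) t i *v wp t i)"

fun mpc_state ::
  "real^'n^'n \<Rightarrow> real^'u^'n \<Rightarrow> real^'n^'n \<Rightarrow> nat \<Rightarrow> nat \<Rightarrow>
   (nat \<Rightarrow> real^'n^'n) \<Rightarrow> (nat \<Rightarrow> real^'u^'u) \<Rightarrow> (nat \<Rightarrow> real^'n) \<Rightarrow> (nat \<Rightarrow> nat \<Rightarrow> real^'n) \<Rightarrow>
   real^'n \<Rightarrow> nat \<Rightarrow> real^'n" where
  "mpc_state A B Pm T W Q R w wp x1 0 = x1"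
| "mpc_state A B Pm T W Q R w wp x1 (Suc t) =
     (if t = 0 then x1
      else A *v mpc_state A B Pm T W Q R w wp x1 t
           + B *v mpc_control A B Pm T W Q R wp t (mpc_state A B Pm T W Q R w wp x1 t)
           + w t)"

definition mpc_input ::
  "real^'n^'n \<Rightarrow> real^'u^'n \<Rightarrow> real^'n^'n \<Rightarrow> nat \<Rightarrow> nat \<Rightarrow>
   (nat \<Rightarrow> real^'n^'n) \<Rightarrow> (nat \<Rightarrow> real^'u^'u) \<Rightarrow> (nat \<Rightarrow> real^'n) \<Rightarrow> (nat \<Rightarrow> nat \<Rightarrow> real^'n) \<Rightarrow>
   real^'n \<Rightarrow> nat \<Rightarrow> real^'u" where
  "mpc_input A B Pm T W Q R w wp x1 t =
     mpc_control A B Pm T W Q R wp t (mpc_state A B Pm T W Q R w wp x1 t)"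

definition mpc_regret ::
  "real^'n^'n \<Rightarrow> real^'u^'n \<Rightarrow> real^'n^'n \<Rightarrow> nat \<Rightarrow> nat \<Rightarrow>
   (nat \<Rightarrow> real^'n^'n) \<Rightarrow> (nat \<Rightarrow> real^'u^'u) \<Rightarrow> (nat \<Rightarrow> real^'n) \<Rightarrow> (nat \<Rightarrow> nat \<Rightarrow> real^'n) \<Rightarrow>
   real^'n \<Rightarrow> real" where
  "mpc_regret A B Pm T W Q R w wp x1 =
     cost T Q R (mpc_state A B Pm T W Q R w wp x1) (mpc_input A B Pm T W Q R w wp x1)
     - opt_cost A B T Q R w x1"

definition rho_rate :: "real^'n^'n \<Rightarrow> real^'n^'n \<Rightarrow> real" where
  "rho_rate Qmin Pm = sqrt (1 - lambda_min Qmin / lambda_max Pm)"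

definition gamma_rate :: "real^'n^'n \<Rightarrow> real^'n^'n \<Rightarrow> real^'n^'n \<Rightarrow> real" where
  "gamma_rate A Qmin Pm =
     lambda_max (transpose A ** Pm ** A)
       / (lambda_min Qmin + lambda_max (transpose A ** Pm ** A))"

definition mixed_rate :: "real \<Rightarrow> real \<Rightarrow> nat \<Rightarrow> real" where
  "mixed_rate \<rho> \<gamma> W =
     (if \<rho> = \<gamma> then (\<Sum>i<W. \<gamma> ^ (W - i) * \<rho> ^ i)
      else \<gamma> * ((\<rho> ^ W - \<gamma> ^ W) / (\<rho> - \<gamma>)))"

definition standing_assms ::
  "real^'n^'n \<Rightarrow> real^'n^'n \<Rightarrow> real^'n^'n \<Rightarrow> real^'u^'u \<Rightarrow> real^'u^'u \<Rightarrow> nat \<Rightarrow>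
   (nat \<Rightarrow> real^'n^'n) \<Rightarrow> (nat \<Rightarrow> real^'u^'u) \<Rightarrow> bool" where
  "standing_assms A Qmin Qmax Rmin Rmax T Q R \<longleftrightarrow>
     (\<forall>t\<in>{1..T}. sym_mat (Q t) \<and> detectable A (Q t) \<and> loewner_le Qmin (Q t) \<and> loewner_le (Q t) Qmax) \<and>
     (\<forall>t\<in>{1..<T}. sym_mat (R t) \<and> loewner_le Rmin (R t) \<and> loewner_le (R t) Rmax)"

end

theory Submission
  imports Defs "HOL-Computational_Algebra.Fundamental_Theorem_Algebra"
begin

text \<open>
  Why the theorem is true. The dynamic programming value function of the disturbed problem is a
  quadratic polynomial in the state, so completing the square at each step shows that the cost of
  any control sequence is a constant plus the sum of the squared deviations of the controls from
  the optimal feedback at the states actually visited, weighted with the Hessians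
  \<open>R\<^sub>t + B\<^sup>T P\<^sub>t\<^sub>+\<^sub>1 B\<close> (\<open>cost_eq_deviations\<close>). Hence the regret is at most such a sum
  (\<open>regret_le_deviations\<close>), and it remains to bound the deviation of the predictive controller
  from the optimal feedback at the same state.

  Two contraction properties supply the rates. First, the Riccati map contracts multiplicative
  perturbations of its argument with the factor \<open>\<gamma>\<close> (\<open>riccati_F_contraction\<close>): if
  \<open>P' \<le> (1 + e) P\<close>, then \<open>F(P') \<le> (1 + \<gamma> e) F(P)\<close>, because the state cost
  \<open>Q\<close> is not scaled and makes up at least the fraction \<open>1 - \<gamma>\<close> of \<open>F(P)\<close>. So the
  recursion from \<open>P\<^sub>m\<^sub>a\<^sub>x\<close> and the optimal recursion are \<open>\<gamma>\<^sup>k\<close>-close after \<open>k\<close> steps.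
  Second, the cost to go is a Lyapunov function of the closed loop, and one step consumes the
  fraction \<open>1 - \<rho>\<^sup>2\<close> of it (\<open>closed_loop_step\<close>), so products of \<open>k\<close> closed-loop matrices
  are of size \<open>\<rho>\<^sup>k\<close>. The same Lyapunov argument applies to the closed loop of the
  predictive controller, whose gains come from different recursions, since its terminal matrices
  only decrease as the window moves (\<open>mpc_closed_loop_step\<close>).

  The deviation therefore has three parts (\<open>norm_deviation_le\<close>). The gain error is of size
  \<open>\<gamma>\<^sup>W\<close> times the state. The disturbance \<open>k\<close> steps ahead enters with the weight
  \<open>\<rho>\<^sup>k \<gamma>\<^sup>W\<^sup>-\<^sup>k\<close> inside the window and \<open>\<rho>\<^sup>k\<close> beyond it; these weights sum to at most
  \<open>\<rho>\<^sup>W / (1 - \<rho>)\<close> plus the mixed term (\<open>sum_window_weight_le\<close>). The prediction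
  errors enter with the weights \<open>\<rho>\<^sup>k\<close>. Young's inequality for these convolutions and an energy
  estimate for the states (\<open>sum_state_le\<close>) give the bound (\<open>mpc_regret_le\<close>).

  It also has to be shown that \<open>P\<^sub>m\<^sub>a\<^sub>x\<close> is well defined: the algebraic Riccati equation
  has exactly one positive definite solution. Uniqueness is the contraction again; existence is
  value iteration, which is bounded by the cost of a stabilizing feedback. That this cost is finite
  needs the passage from the eigenvalues of a Schur stable matrix to summability of its orbits
  (\<open>schur_stable_summable_orbit\<close>).

  Throughout, symmetric matrices are compared through their quadratic forms.
\<close>

section \<open>Quadratic forms and the operator norm\<close>

text \<open>The lemmas below move a transposed matrix across the inner product. Rewriting
  \<open>transpose M *v x\<close> to a row vector product would hide these redexes.\<close>

declare transpose_matrix_vector [simp del]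

lemma inner_transpose_left:
  fixes M :: "real^'n^'m"
  shows "(transpose M *v x) \<bullet> y = x \<bullet> (M *v y)"
  by (simp add: transpose_matrix_vector dot_lmul_matrix)

lemma inner_transpose_right:
  fixes M :: "real^'n^'m"
  shows "y \<bullet> (transpose M *v x) = (M *v y) \<bullet> x"
  by (metis inner_commute inner_transpose_left)

lemma sym_mat_inner: "sym_mat M \<Longrightarrow> (M *v x) \<bullet> y = x \<bullet> (M *v y)"
  by (metis inner_transpose_left sym_mat_def)

lemma transpose_add: "transpose (M + N) = transpose M + transpose N"
  and transpose_diff: "transpose (M - N) = transpose M - transpose N"
  for M N :: "real^'n^'m"
  by (simp_all add: transpose_def vec_eq_iff)

definition quad :: "real^'n^'n \<Rightarrow> real^'n \<Rightarrow> real" where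
  "quad M x = x \<bullet> (M *v x)"

definition psd :: "real^'n^'n \<Rightarrow> bool" where
  "psd M \<longleftrightarrow> sym_mat M \<and> (\<forall>x. 0 \<le> quad M x)"

lemma quad_zero [simp]: "quad M 0 = 0"
  by (simp add: quad_def)

lemma quad_add_matrix: "quad (M + N) x = quad M x + quad N x"
  and quad_diff_matrix: "quad (M - N) x = quad M x - quad N x"
  by (simp_all add: quad_def matrix_vector_mult_add_rdistrib matrix_vector_mult_diff_rdistrib
      inner_add_right inner_diff_right)

lemma quad_scaleR: "quad M (c *\<^sub>R x) = c\<^sup>2 * quad M x"
  by (simp add: quad_def matrix_vector_mult_scaleR power2_eq_square)

lemma quad_add:
  "sym_mat M \<Longrightarrow> quad M (x + y) = quad M x + 2 * (x \<bullet> (M *v y)) + quad M y"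
  by (simp add: quad_def matrix_vector_right_distrib inner_add_left inner_add_right)
     (metis inner_commute sym_mat_inner)

lemma quad_transpose_mult: "quad (transpose M ** N ** M) x = quad N (M *v x)"
  by (simp add: quad_def matrix_vector_mul_assoc[symmetric] inner_transpose_right)

lemma sym_mat_transpose_mult: "sym_mat N \<Longrightarrow> sym_mat (transpose M ** N ** M)"
  by (simp add: sym_mat_def matrix_transpose_mul matrix_mul_assoc)

lemma sym_mat_add: "sym_mat M \<Longrightarrow> sym_mat N \<Longrightarrow> sym_mat (M + N)"
  and sym_mat_diff: "sym_mat M \<Longrightarrow> sym_mat N \<Longrightarrow> sym_mat (M - N)"
  by (simp_all add: sym_mat_def transpose_add transpose_diff)

lemma quad_polarization:
  "sym_mat M \<Longrightarrow> 4 * (x \<bullet> (M *v y)) = quad M (x + y) - quad M (x - y)"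
  by (simp add: quad_def matrix_vector_right_distrib matrix_vector_mult_diff_distrib
      inner_add_left inner_add_right inner_diff_left inner_diff_right)
     (metis inner_commute sym_mat_inner)

lemma quad_eqI:
  assumes "sym_mat M" "sym_mat N" "\<And>x. quad M x = quad N x"
  shows "M = N"
proof -
  have "x \<bullet> (M *v y) = x \<bullet> (N *v y)" for x y
    using quad_polarization[OF assms(1), of x y] quad_polarization[OF assms(2), of x y] assms(3)
    by simp
  then show ?thesis
    by (metis matrix_eq vector_eq_rdot inner_commute)
qed

lemma pos_def_iff_quad: "pos_def M \<longleftrightarrow> sym_mat M \<and> (\<forall>x. x \<noteq> 0 \<longrightarrow> quad M x > 0)"
  by (simp add: pos_def_def quad_def)

lemma pos_def_imp_psd: "pos_def M \<Longrightarrow> psd M"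
  unfolding pos_def_iff_quad psd_def by (metis less_imp_le order_refl quad_zero)

lemma loewner_le_quad: "loewner_le M N \<Longrightarrow> quad M x \<le> quad N x"
  by (metis loewner_le_def quad_def quad_diff_matrix diff_ge_0_iff_ge)

lemma pos_def_inverse:
  assumes "pos_def G"
  shows "matrix_inv G ** G = mat 1" "G ** matrix_inv G = mat 1"
proof -
  have "G *v x = 0 \<Longrightarrow> x = 0" for x
    using assms unfolding pos_def_def by (metis inner_zero_right less_irrefl)
  then have "invertible G"
    using invertible_left_inverse matrix_left_invertible_ker by blast
  then have "G ** matrix_inv G = mat 1 \<and> matrix_inv G ** G = mat 1"
    unfolding invertible_def matrix_inv_def by (rule someI_ex)
  then show "matrix_inv G ** G = mat 1" "G ** matrix_inv G = mat 1"
    by simp_all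
qed

abbreviation opnorm :: "real^'n^'m \<Rightarrow> real" where
  "opnorm M \<equiv> onorm ((*v) M)"

lemma norm_le_opnorm: "norm (M *v x) \<le> opnorm M * norm x"
  by (intro onorm matrix_vector_mul_bounded_linear)

lemma opnorm_le: "(\<And>x. norm (M *v x) \<le> c * norm x) \<Longrightarrow> opnorm M \<le> c"
  by (rule onorm_le)

lemma opnorm_nonneg: "0 \<le> opnorm M"
  by (intro onorm_pos_le matrix_vector_mul_bounded_linear)

lemma opnorm_zero [simp]: "opnorm 0 = 0"
  by (intro antisym opnorm_nonneg opnorm_le) simp

lemma opnorm_mult_le: "opnorm (M ** N) \<le> opnorm M * opnorm N"
proof (rule opnorm_le)
  fix x
  have "norm (M *v (N *v x)) \<le> opnorm M * (opnorm N * norm x)"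
    by (meson norm_le_opnorm mult_left_mono opnorm_nonneg order_trans)
  then show "norm ((M ** N) *v x) \<le> opnorm M * opnorm N * norm x"
    by (simp add: matrix_vector_mul_assoc mult.assoc)
qed

lemma opnorm_mult_mono:
  "opnorm M \<le> a \<Longrightarrow> opnorm N \<le> b \<Longrightarrow> opnorm (M ** N) \<le> a * b"
  by (meson opnorm_mult_le mult_mono opnorm_nonneg order_trans)

lemma opnorm_add_le: "opnorm (M + N) \<le> opnorm M + opnorm N"
proof (rule opnorm_le)
  fix x
  have "norm (M *v x + N *v x) \<le> opnorm M * norm x + opnorm N * norm x"
    by (meson norm_triangle_ineq norm_le_opnorm add_mono order_trans)
  then show "norm ((M + N) *v x) \<le> (opnorm M + opnorm N) * norm x"
    by (simp add: matrix_vector_mult_add_rdistrib distrib_right)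
qed

lemma opnorm_minus: "opnorm (- M) = opnorm M"
proof -
  have "(*v) (- M) = (\<lambda>x. - (M *v x))"
    using matrix_vector_mult_diff_rdistrib[of 0 M] by auto
  then show ?thesis
    by (simp add: onorm_neg)
qed

lemma opnorm_transpose_le: "opnorm (transpose M) \<le> opnorm M"
proof (rule opnorm_le)
  fix y
  let ?z = "transpose M *v y"
  have "norm ?z * norm ?z = y \<bullet> (M *v ?z)"
    by (metis inner_transpose_left norm_eq_sqrt_inner real_sqrt_mult_self
        abs_of_nonneg inner_ge_zero)
  also have "\<dots> \<le> norm y * (opnorm M * norm ?z)"
    by (meson norm_cauchy_schwarz norm_le_opnorm mult_left_mono norm_ge_zero order_trans)
  finally show "norm ?z \<le> opnorm M * norm y"
    by (cases "norm ?z = 0") (simp_all add: opnorm_nonneg ac_simps)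
qed

lemma quad_le_opnorm: "\<bar>quad M x\<bar> \<le> opnorm M * (norm x)\<^sup>2"
proof -
  have "\<bar>quad M x\<bar> \<le> norm x * (opnorm M * norm x)"
    unfolding quad_def
    by (meson Cauchy_Schwarz_ineq2 norm_le_opnorm mult_left_mono norm_ge_zero order_trans)
  then show ?thesis
    by (simp add: power2_eq_square ac_simps)
qed

text \<open>A vector \<open>D y\<close> is tested against the form itself: expanding
  \<open>quad D (y - s *\<^sub>R (D *v y)) \<ge> 0\<close> at the best \<open>s\<close> is the Cauchy--Schwarz inequality for the
  possibly degenerate form of \<open>D\<close>.\<close>

lemma opnorm_le_of_quad:
  assumes "psd D" and "0 \<le> d" and "\<And>x. quad D x \<le> d * (norm x)\<^sup>2"
  shows "opnorm D \<le> d"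
proof (rule opnorm_le)
  fix y
  let ?z = "D *v y"
  have sym: "sym_mat D" and nonneg: "0 \<le> quad D x" for x
    using assms(1) by (auto simp: psd_def)
  have exp: "0 \<le> quad D y - 2 * s * (norm ?z)\<^sup>2 + s\<^sup>2 * (d * (norm ?z)\<^sup>2)" for s
  proof -
    have "0 \<le> quad D (y + (- s) *\<^sub>R ?z)"
      by (rule nonneg)
    also have "\<dots> = quad D y - 2 * s * (norm ?z)\<^sup>2 + s\<^sup>2 * quad D ?z"
      by (simp only: quad_add[OF sym] quad_scaleR)
         (simp add: matrix_vector_mult_scaleR sym_mat_inner[OF sym, symmetric]
           power2_norm_eq_inner)
    finally show ?thesis
      using mult_left_mono[OF assms(3)[of ?z], of "s\<^sup>2"] by simp
  qed
  show "norm ?z \<le> d * norm y"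
  proof (cases "d = 0")
    case True
    have "2 * (norm ?z)\<^sup>2 \<le> quad D y" "quad D y \<le> 0"
      using exp[of 1] assms(3)[of y] True by simp_all
    then have "2 * (norm ?z)\<^sup>2 \<le> 0"
      by (rule order_trans)
    with True show ?thesis by simp
  next
    case False
    with assms(2) have d: "d > 0" by simp
    have "(norm ?z)\<^sup>2 \<le> d * quad D y"
      using exp[of "1 / d"] d by (simp add: field_simps power2_eq_square)
    also have "\<dots> \<le> d * (d * (norm y)\<^sup>2)"
      using d assms(3)[of y] by (intro mult_left_mono) auto
    finally have "(norm ?z)\<^sup>2 \<le> (d * norm y)\<^sup>2"
      by (simp add: power2_eq_square ac_simps)
    then show ?thesis
      using d by (simp add: power2_le_iff_abs_le)
  qed
qed

lemma opnorm_inverse_le: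
  assumes "pos_def G" and "r > 0" and "\<And>x. r * (norm x)\<^sup>2 \<le> quad G x"
  shows "opnorm (matrix_inv G) \<le> 1 / r"
proof (rule opnorm_le)
  fix y
  let ?x = "matrix_inv G *v y"
  have "r * (norm ?x)\<^sup>2 \<le> ?x \<bullet> y"
    using assms(3)[of ?x]
    by (simp add: quad_def matrix_vector_mul_assoc pos_def_inverse[OF assms(1)])
  also have "\<dots> \<le> norm ?x * norm y"
    by (rule norm_cauchy_schwarz)
  finally show "norm ?x \<le> 1 / r * norm y"
    using assms(2) by (cases "?x = 0") (simp_all add: power2_eq_square field_simps)
qed

section \<open>Extreme eigenvalues of a symmetric matrix\<close>

text \<open>The first variation vanishes at a maximizer \<open>v\<close> of \<open>quad M\<close> on the unit sphere. In
  terms of \<open>N = l I - M\<close>, where \<open>l\<close> is the maximum: the form of \<open>N\<close> is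
  nonnegative and vanishes at \<open>v\<close>, and at \<open>v - s z\<close> with \<open>z = N v\<close> it has the first
  order term \<open>- 2 s\<close> times the squared norm of \<open>z\<close>, so that \<open>z = 0\<close>.\<close>

lemma rayleigh_max_eigenval:
  fixes M :: "real^'n^'n"
  assumes "sym_mat M"
  obtains l where "is_eigenval M l" "\<And>x. quad M x \<le> l * (norm x)\<^sup>2"
proof -
  have "continuous_on (sphere 0 1) (quad M)"
    unfolding quad_def
    by (intro continuous_intros linear_continuous_on matrix_vector_mul_bounded_linear)
  moreover have "compact (sphere (0::real^'n) 1)" "sphere (0::real^'n) 1 \<noteq> {}"
    by auto
  ultimately obtain v where v: "norm v = 1"
    and max: "\<And>x. norm x = 1 \<Longrightarrow> quad M x \<le> quad M v"
    using continuous_attains_sup[of "sphere 0 1" "quad M"] by (metis dist_0_norm mem_sphere)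
  define l where "l = quad M v"
  have le: "quad M x \<le> l * (norm x)\<^sup>2" for x
  proof (cases "x = 0")
    case False
    have "quad M (inverse (norm x) *\<^sub>R x) \<le> l"
      unfolding l_def by (rule max) (use False in simp)
    then show ?thesis
      using False by (simp add: quad_scaleR field_simps)
  qed simp
  let ?N = "mat l - M"
  have matl: "mat l *v x = l *\<^sub>R x" for x :: "real^'n"
    by (simp add: vec_eq_iff matrix_vector_mult_def mat_def if_distrib[of "\<lambda>c. c * _"] cong: if_cong)
  have quadN: "quad ?N x = l * (norm x)\<^sup>2 - quad M x" for x
    by (simp add: quad_def matrix_vector_mult_diff_rdistrib inner_diff_right matl
        power2_norm_eq_inner)
  have symN: "sym_mat ?N"
    by (intro sym_mat_diff assms) (simp add: sym_mat_def)
  define c where "c = opnorm ?N"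
  \<comment> \<open>The step \<open>1 / (c + 1)\<close> is small enough for the first order term to dominate.\<close>
  have "norm (?N *v v) \<le> c * 0"
    if "quad ?N v = 0"
  proof -
    let ?z = "?N *v v"
    have "0 \<le> - 2 * s * (norm ?z)\<^sup>2 + s\<^sup>2 * (c * (norm ?z)\<^sup>2)" for s
    proof -
      have "0 \<le> quad ?N (v + (- s) *\<^sub>R ?z)"
        using le quadN by (metis diff_ge_0_iff_ge)
      also have "\<dots> = - 2 * s * (norm ?z)\<^sup>2 + s\<^sup>2 * quad ?N ?z"
        using that by (simp only: quad_add[OF symN] quad_scaleR)
          (simp add: matrix_vector_mult_scaleR sym_mat_inner[OF symN, symmetric]
            power2_norm_eq_inner)
      finally show ?thesis
        using mult_left_mono[OF order_trans[OF abs_ge_self quad_le_opnorm[of ?N ?z]], of "s\<^sup>2"]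
        unfolding c_def by simp
    qed
    note * = this[of "1 / (c + 1)"]
    have c: "0 \<le> c" unfolding c_def by (rule opnorm_nonneg)
    have "0 \<le> (norm ?z)\<^sup>2 * (- 2 * (1 / (c + 1)) + (1 / (c + 1))\<^sup>2 * c)"
      using * by (simp add: algebra_simps)
    moreover have "- 2 * (1 / (c + 1)) + (1 / (c + 1))\<^sup>2 * c = - (c + 2) / (c + 1)\<^sup>2"
      using c by (simp add: divide_simps power2_eq_square)
    moreover have "- (c + 2) / (c + 1)\<^sup>2 < 0"
      using c by (intro divide_neg_pos) auto
    ultimately have "(norm ?z)\<^sup>2 \<le> 0"
      by (simp add: zero_le_mult_iff)
    then show ?thesis by simp
  qed
  moreover have "quad ?N v = 0"
    using v quadN[of v] by (simp add: l_def)
  ultimately have "M *v v = l *s v"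
    by (simp add: matrix_vector_mult_diff_rdistrib matl scalar_mult_eq_scaleR)
  with v have "is_eigenval M l"
    unfolding is_eigenval_def by (metis norm_zero zero_neq_one)
  with le that show thesis by blast
qed

lemma eigenval_le_rayleigh:
  assumes "is_eigenval M l" and "\<And>x. quad M x \<le> c * (norm x)\<^sup>2"
  shows "l \<le> c"
proof -
  obtain v where v: "v \<noteq> 0" "M *v v = l *\<^sub>R v"
    using assms(1) by (auto simp: is_eigenval_def scalar_mult_eq_scaleR)
  have "l * (norm v)\<^sup>2 \<le> c * (norm v)\<^sup>2"
    using assms(2)[of v] v by (simp add: quad_def power2_norm_eq_inner)
  with v show ?thesis by simp
qed

lemma finite_eigenvals:
  fixes M :: "real^'n^'n"
  assumes "sym_mat M"
  shows "finite {l. is_eigenval M l}"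
proof -
  define v where "v l = (SOME x. x \<noteq> 0 \<and> M *v x = l *s x)" for l
  have v: "v l \<noteq> 0 \<and> M *v v l = l *s v l" if "is_eigenval M l" for l
    using that unfolding is_eigenval_def v_def by (rule someI_ex)
  have orth: "v l \<bullet> v m = 0" if "is_eigenval M l" "is_eigenval M m" "l \<noteq> m" for l m
  proof -
    have "l * (v l \<bullet> v m) = m * (v l \<bullet> v m)"
      using sym_mat_inner[OF assms, of "v l" "v m"] v[OF that(1)] v[OF that(2)]
      by (simp add: scalar_mult_eq_scaleR)
    with that show ?thesis by simp
  qed
  have "inj_on v {l. is_eigenval M l}"
  proof (rule inj_onI, rule ccontr)
    fix l m assume "l \<in> {l. is_eigenval M l}" "m \<in> {l. is_eigenval M l}" "v l = v m" "l \<noteq> m"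
    with orth[of l m] v[of m] show False by simp
  qed
  moreover have "independent (v ` {l. is_eigenval M l})"
  proof (rule pairwise_orthogonal_independent)
    show "pairwise orthogonal (v ` {l. is_eigenval M l})"
      using orth by (force simp: pairwise_def orthogonal_def)
    show "0 \<notin> v ` {l. is_eigenval M l}"
      using v by force
  qed
  then have "finite (v ` {l. is_eigenval M l})"
    by (simp add: independent_imp_finite)
  ultimately show ?thesis
    using finite_imageD by blast
qed

lemma quad_le_lambda_max:
  assumes "sym_mat M"
  shows "quad M x \<le> lambda_max M * (norm x)\<^sup>2"
proof -
  obtain l where l: "is_eigenval M l" "\<And>x. quad M x \<le> l * (norm x)\<^sup>2"
    using rayleigh_max_eigenval[OF assms] by blast
  have "lambda_max M = l"
    unfolding lambda_max_def
    by (rule Max_eqI) (use finite_eigenvals[OF assms] eigenval_le_rayleigh l in auto)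
  with l show ?thesis by simp
qed

lemma lambda_max_is_eigenval:
  assumes "sym_mat M"
  shows "is_eigenval M (lambda_max M)"
proof -
  have "{l. is_eigenval M l} \<noteq> {}"
    using rayleigh_max_eigenval[OF assms] by blast
  then show ?thesis
    using Max_in[OF finite_eigenvals[OF assms]] by (simp add: lambda_max_def)
qed

lemma is_eigenval_minus: "is_eigenval (- M) l \<longleftrightarrow> is_eigenval M (- l)" for M :: "real^'n^'n"
proof -
  have "- M *v v = - (M *v v)" for v
    using matrix_vector_mult_diff_rdistrib[of 0 M v] by simp
  then show ?thesis
    by (simp add: is_eigenval_def scalar_mult_eq_scaleR)
       (metis minus_equation_iff)
qed

lemma
  fixes M :: "real^'n^'n"
  assumes "sym_mat M"
  shows lambda_min_le_quad: "lambda_min M * (norm x)\<^sup>2 \<le> quad M x"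
    and lambda_min_is_eigenval: "is_eigenval M (lambda_min M)"
proof -
  have sym: "sym_mat (- M)"
    using assms by (simp add: sym_mat_def transpose_def vec_eq_iff)
  have qm: "quad (- M) x = - quad M x" for x
    using quad_diff_matrix[of 0 M x] by (simp add: quad_def)
  obtain l where l: "is_eigenval (- M) l" "\<And>x. quad (- M) x \<le> l * (norm x)\<^sup>2"
    using rayleigh_max_eigenval[OF sym] by blast
  have "lambda_min M = - l"
    unfolding lambda_min_def
  proof (rule Min_eqI)
    fix m assume "m \<in> {l. is_eigenval M l}"
    then have "is_eigenval (- M) (- m)"
      by (simp add: is_eigenval_minus)
    from eigenval_le_rayleigh[OF this l(2)] show "- l \<le> m" by simp
  qed (use finite_eigenvals[OF assms] l in \<open>auto simp: is_eigenval_minus\<close>)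
  with l qm show "lambda_min M * (norm x)\<^sup>2 \<le> quad M x" "is_eigenval M (lambda_min M)"
    by (simp_all add: is_eigenval_minus minus_le_iff)
qed

lemma eigenval_quad:
  assumes "is_eigenval M l"
  obtains v where "v \<noteq> 0" "quad M v = l * (norm v)\<^sup>2"
proof -
  obtain v where v: "v \<noteq> 0" "M *v v = l *\<^sub>R v"
    using assms by (auto simp: is_eigenval_def scalar_mult_eq_scaleR)
  then have "quad M v = l * (norm v)\<^sup>2"
    by (simp add: quad_def power2_norm_eq_inner)
  with v that show thesis by blast
qed

lemma lambda_min_pos: "pos_def M \<Longrightarrow> lambda_min M > 0"
  using lambda_min_is_eigenval[of M] unfolding pos_def_iff_quad
  by (metis eigenval_quad zero_less_mult_pos2 zero_less_norm_iff zero_less_power)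

lemma lambda_max_nonneg: "psd M \<Longrightarrow> lambda_max M \<ge> 0"
  using lambda_max_is_eigenval[of M] unfolding psd_def
  by (metis eigenval_quad zero_le_mult_iff not_le zero_less_norm_iff zero_less_power)

section \<open>The Riccati map\<close>

definition lq_hess :: "real^'u^'n \<Rightarrow> real^'u^'u \<Rightarrow> real^'n^'n \<Rightarrow> real^'u^'u" where
  "lq_hess B R P = R + transpose B ** P ** B"

definition lq_gain ::
  "real^'n^'n \<Rightarrow> real^'u^'n \<Rightarrow> real^'u^'u \<Rightarrow> real^'n^'n \<Rightarrow> real^'n^'u" where
  "lq_gain A B R P = matrix_inv (lq_hess B R P) ** transpose B ** P ** A"

lemma gain_eq_lq_gain: "gain A B R P t = lq_gain A B (R t) (P (t + 1))"
  by (simp add: gain_def lq_gain_def lq_hess_def)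

lemma quad_lq_hess: "quad (lq_hess B R P) u = quad R u + quad P (B *v u)"
  by (simp add: lq_hess_def quad_add_matrix quad_transpose_mult)

lemma pos_def_lq_hess:
  assumes "pos_def R" and "psd P"
  shows "pos_def (lq_hess B R P)"
  using assms unfolding pos_def_iff_quad psd_def quad_lq_hess
  by (auto simp: lq_hess_def intro!: sym_mat_add sym_mat_transpose_mult add_pos_nonneg)

lemma lq_hess_gain:
  assumes "pos_def R" and "psd P"
  shows "lq_hess B R P *v (lq_gain A B R P *v x) = transpose B *v (P *v (A *v x))"
  using pos_def_inverse(2)[OF pos_def_lq_hess[OF assms, of B]]
  by (simp add: lq_gain_def matrix_vector_mul_assoc matrix_mul_assoc)

lemma quad_riccati_F:
  assumes "sym_mat P"
  shows "quad (riccati_F A B Q R P) x =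
    quad Q x + quad P (A *v x) - (A *v x) \<bullet> (P *v (B *v (lq_gain A B R P *v x)))"
proof -
  have "riccati_F A B Q R P =
      Q + transpose A ** P ** A - transpose A ** P ** B ** lq_gain A B R P"
    by (simp only: riccati_F_def lq_gain_def lq_hess_def matrix_mul_assoc)
  moreover have "quad (transpose A ** P ** B ** lq_gain A B R P) x =
      (A *v x) \<bullet> (P *v (B *v (lq_gain A B R P *v x)))"
    by (simp only: quad_def matrix_vector_mul_assoc[symmetric] inner_transpose_right)
  ultimately show ?thesis
    by (simp only: quad_add_matrix quad_diff_matrix quad_transpose_mult)
qed

text \<open>Completing the square: the control \<open>- K x\<close> minimizes the cost of one step followed by the
  terminal cost \<open>P\<close>, and the minimum is the form of \<open>F(P)\<close>. All order properties of the Riccati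
  map below come from this variational characterization.\<close>

lemma riccati_complete_square:
  assumes "pos_def R" and "psd P"
  shows "quad Q x + quad R u + quad P (A *v x + B *v u) =
    quad (riccati_F A B Q R P) x + quad (lq_hess B R P) (u + lq_gain A B R P *v x)"
proof -
  let ?k = "lq_gain A B R P *v x"
  have symP: "sym_mat P" using assms by (simp add: psd_def)
  have symG: "sym_mat (lq_hess B R P)"
    using pos_def_lq_hess[OF assms] by (simp add: pos_def_def)
  have G: "v \<bullet> (lq_hess B R P *v ?k) = (A *v x) \<bullet> (P *v (B *v v))" for v
    by (simp only: lq_hess_gain[OF assms] inner_transpose_right)
       (metis inner_commute sym_mat_inner[OF symP])
  have k: "quad (lq_hess B R P) ?k = (A *v x) \<bullet> (P *v (B *v ?k))"
    by (simp only: quad_def G)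
  show ?thesis
    unfolding quad_add[OF symP] quad_add[OF symG] quad_riccati_F[OF symP] k G
    by (simp add: quad_lq_hess)
qed

lemma quad_riccati_F_le:
  assumes "pos_def R" and "psd P"
  shows "quad (riccati_F A B Q R P) x \<le> quad Q x + quad R u + quad P (A *v x + B *v u)"
  using riccati_complete_square[OF assms, of Q x u A B]
    pos_def_imp_psd[OF pos_def_lq_hess[OF assms, of B]]
  by (simp add: psd_def)

lemma quad_riccati_F_gain:
  assumes "pos_def R" and "psd P"
  shows "quad (riccati_F A B Q R P) x =
    quad Q x + quad R (- (lq_gain A B R P *v x)) + quad P ((A - B ** lq_gain A B R P) *v x)"
  using riccati_complete_square[OF assms, of Q x "- (lq_gain A B R P *v x)" A B]
  by (simp add: matrix_vector_mult_diff_rdistrib matrix_vector_mul_assoc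
      matrix_vector_mult_diff_distrib[of B 0, simplified])

lemma sym_mat_riccati_F:
  assumes "pos_def R" and "psd P" and "sym_mat Q"
  shows "sym_mat (riccati_F A B Q R P)"
proof -
  let ?K = "lq_gain A B R P" and ?G = "lq_hess B R P"
  have G: "?G ** ?K = transpose B ** P ** A"
    using lq_hess_gain[OF assms(1,2), of B A]
    by (simp add: matrix_eq matrix_vector_mul_assoc[symmetric])
  have symP: "transpose P = P" using assms by (simp add: psd_def sym_mat_def)
  have symG: "sym_mat ?G"
    using pos_def_lq_hess[OF assms(1,2)] by (simp add: pos_def_def)
  have "transpose A ** P ** B = transpose (?G ** ?K)"
    by (simp add: G matrix_transpose_mul symP matrix_mul_assoc)
  also have "\<dots> = transpose ?K ** ?G"
    using symG by (simp add: matrix_transpose_mul sym_mat_def)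
  finally have "riccati_F A B Q R P = Q + transpose A ** P ** A - transpose ?K ** ?G ** ?K"
    by (simp add: riccati_F_def lq_gain_def lq_hess_def matrix_mul_assoc)
  then show ?thesis
    using assms symG
    by (auto intro!: sym_mat_diff sym_mat_add sym_mat_transpose_mult simp: psd_def)
qed

lemma riccati_F_ge:
  assumes "pos_def R" and "psd P"
  shows "quad Q x \<le> quad (riccati_F A B Q R P) x"
  using quad_riccati_F_gain[OF assms, of A B Q x] pos_def_imp_psd[OF assms(1)] assms(2)
  by (simp add: psd_def)

lemma psd_riccati_F:
  assumes "pos_def R" and "psd P" and "psd Q"
  shows "psd (riccati_F A B Q R P)"
  using assms sym_mat_riccati_F riccati_F_ge unfolding psd_def by (meson order_trans)

lemma riccati_F_mono:
  assumes R: "pos_def R" "pos_def R'" and P: "psd P" "psd P'"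
    and "\<And>x. quad Q x \<le> quad Q' x" "\<And>u. quad R u \<le> quad R' u" "\<And>x. quad P x \<le> quad P' x"
  shows "quad (riccati_F A B Q R P) x \<le> quad (riccati_F A B Q' R' P') x"
proof -
  let ?K = "lq_gain A B R' P'"
  have "quad (riccati_F A B Q R P) x \<le>
      quad Q x + quad R (- (?K *v x)) + quad P (A *v x + B *v (- (?K *v x)))"
    by (rule quad_riccati_F_le[OF R(1) P(1)])
  also have "\<dots> \<le> quad Q' x + quad R' (- (?K *v x)) + quad P' (A *v x + B *v (- (?K *v x)))"
    by (intro add_mono assms)
  also have "\<dots> = quad (riccati_F A B Q' R' P') x"
    by (simp add: riccati_complete_square[OF R(2) P(2)])
  finally show ?thesis .
qed

text \<open>The Riccati map is a contraction for multiplicative perturbations. Scaling the terminal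
  cost by \<open>1 + e\<close> scales at most the terminal part and the control cost, but not the state cost
  \<open>Q\<close>, and \<open>Q\<close> is at least the fraction \<open>1 - \<gamma>\<close> of \<open>F(P)\<close>: by the choice \<open>u = 0\<close>,
  \<open>F(P) \<le> Q + A\<^sup>T P A\<close>, where \<open>A\<^sup>T P A\<close> is at most \<open>a / q\<close> times \<open>Q\<close>.\<close>

lemma riccati_F_contraction:
  assumes R: "pos_def R" and P: "psd P" "psd P'"
    and q: "q > 0" "\<And>x. q * (norm x)\<^sup>2 \<le> quad Q x"
    and a: "\<And>x. quad P (A *v x) \<le> a * (norm x)\<^sup>2" "a \<ge> 0"
    and e: "e \<ge> 0" "\<And>x. quad P' x \<le> (1 + e) * quad P x"
  shows "quad (riccati_F A B Q R P') x \<le> (1 + a / (q + a) * e) * quad (riccati_F A B Q R P) x"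
proof -
  let ?F = "quad (riccati_F A B Q R P) x" and ?u = "- (lq_gain A B R P *v x)"
  let ?y = "A *v x + B *v ?u"
  have "quad (riccati_F A B Q R P') x \<le> quad Q x + quad R ?u + quad P' ?y"
    by (rule quad_riccati_F_le[OF R P(2)])
  also have "\<dots> \<le> quad Q x + quad R ?u + (1 + e) * quad P ?y"
    using e by simp
  also have "\<dots> \<le> quad Q x + (1 + e) * (quad R ?u + quad P ?y)"
    using e(1) pos_def_imp_psd[OF R] by (simp add: psd_def algebra_simps)
  also have "quad R ?u + quad P ?y = ?F - quad Q x"
    using riccati_complete_square[OF R P(1), of Q x ?u A B] by simp
  finally have 1: "quad (riccati_F A B Q R P') x \<le> ?F + e * (?F - quad Q x)"
    by (simp add: algebra_simps)
  have "?F \<le> quad Q x + a * (norm x)\<^sup>2"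
    using quad_riccati_F_le[OF R P(1), of A B Q x 0] a(1)[of x] by simp
  then have "q * (?F - quad Q x) \<le> a * (q * (norm x)\<^sup>2)"
    using mult_left_mono[of "?F - quad Q x" "a * (norm x)\<^sup>2" q] q(1) by (simp add: ac_simps)
  also have "\<dots> \<le> a * quad Q x"
    by (intro mult_left_mono q a)
  finally have "(q + a) * (?F - quad Q x) \<le> a * ?F"
    by (simp add: algebra_simps)
  then have "?F - quad Q x \<le> a / (q + a) * ?F"
    using q(1) a(2) by (simp add: field_simps)
  then have "e * (?F - quad Q x) \<le> e * (a / (q + a) * ?F)"
    by (intro mult_left_mono e)
  with 1 show ?thesis by (simp add: algebra_simps)
qed

section \<open>Schur stable matrices have summable orbits\<close>

text \<open>The value of the polynomial \<open>p\<close> at the matrix \<open>M\<close>, applied to \<open>v\<close>, by Horner's rule.\<close>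

definition poly_mv :: "'a::field poly \<Rightarrow> 'a^'n^'n \<Rightarrow> 'a^'n \<Rightarrow> 'a^'n" where
  "poly_mv p M v = fold_coeffs (\<lambda>a w. a *s v + M *v w) p 0"

lemma poly_mv_0 [simp]: "poly_mv 0 M v = 0"
  by (simp add: poly_mv_def)

lemma poly_mv_pCons [simp]: "poly_mv (pCons a p) M v = a *s v + M *v poly_mv p M v"
  by (cases "p = 0 \<and> a = 0") (auto simp: poly_mv_def)

lemma poly_mv_add: "poly_mv (p + q) M v = poly_mv p M v + poly_mv q M v"
  by (induction p q rule: poly_induct2)
     (simp_all add: matrix_vector_right_distrib vec.scale_left_distrib vec.scale_right_distrib algebra_simps)

lemma poly_mv_smult: "poly_mv (smult c p) M v = c *s poly_mv p M v"
  by (induction p)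
     (simp_all add: vector_scalar_commute vec.scale_right_distrib)

lemma poly_mv_apply: "M *v poly_mv p M v = poly_mv p M (M *v v)"
  by (induction p)
     (simp_all add: matrix_vector_right_distrib vector_scalar_commute)

lemma poly_mv_scale: "poly_mv p M (c *s v) = c *s poly_mv p M v"
  by (induction p)
     (simp_all add: vector_scalar_commute vec.scale_right_distrib ac_simps)

lemma poly_mv_diff_vec: "poly_mv p M (v - w) = poly_mv p M v - poly_mv p M w"
  by (induction p)
     (simp_all add: vec.scale_right_diff_distrib matrix_vector_mult_diff_distrib)

lemma poly_mv_linear_factor:
  "poly_mv ([:- l, 1:] * q) M v = M *v poly_mv q M v - l *s poly_mv q M v"
proof -
  have "[:- l, 1:] * q = pCons 0 q + smult (- l) q"
    by simp
  then show ?thesis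
    by (simp only: poly_mv_add poly_mv_smult poly_mv_pCons) simp
qed

lemma poly_mv_sum: "poly_mv (\<Sum>k\<in>I. f k) M v = (\<Sum>k\<in>I. poly_mv (f k) M v)"
  by (induction I rule: infinite_finite_induct) (simp_all add: poly_mv_add)

lemma poly_mv_monom: "poly_mv (monom c k) M v = c *s (((*v) M ^^ k) v)"
  by (induction k) (simp_all add: monom_0 monom_Suc vector_scalar_commute)

text \<open>The vectors \<open>v, M v, M\<^sup>2 v, \<dots>\<close> cannot all be independent, so some nonzero polynomial
  in \<open>M\<close> annihilates \<open>v\<close>.\<close>

lemma annihilating_poly:
  fixes M :: "'a::field^'n^'n"
  obtains p where "p \<noteq> 0" "poly_mv p M v = 0"
proof -
  let ?f = "\<lambda>k. ((*v) M ^^ k) v" and ?I = "{..CARD('n)}"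
  show thesis
  proof (cases "inj_on ?f ?I")
    case True
    have "vec.dependent (?f ` ?I)"
      using vec.independent_card_le_dim[of "?f ` ?I" UNIV] card_image[OF True]
      by (auto simp: vec_dim_card simp del: vec.dim_UNIV)
    then obtain u where u: "(\<Sum>w\<in>?f ` ?I. u w *s w) = 0" and nz: "\<exists>w\<in>?f ` ?I. u w \<noteq> 0"
      by (auto simp: vec.dependent_finite)
    let ?p = "\<Sum>k\<in>?I. monom (u (?f k)) k"
    have "poly_mv ?p M v = 0"
      using u by (simp add: poly_mv_sum poly_mv_monom sum.reindex[OF True])
    moreover have "?p \<noteq> 0"
    proof -
      obtain k where k: "k \<in> ?I" "u (?f k) \<noteq> 0" using nz by blast
      have "coeff ?p k = u (?f k)"
        using k(1) by (simp add: coeff_sum)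
      with k(2) show ?thesis by (metis coeff_0)
    qed
    ultimately show thesis using that by blast
  next
    case False
    then obtain j k where jk: "j \<noteq> k" "?f j = ?f k" by (auto simp: inj_on_def)
    let ?p = "monom 1 j + smult (- 1) (monom 1 k) :: 'a poly"
    have "poly_mv ?p M v = 0"
      by (simp only: poly_mv_add poly_mv_smult poly_mv_monom) (simp add: jk(2))
    moreover have "coeff ?p j = 1"
      using jk(1) by simp
    then have "?p \<noteq> 0"
      by (metis coeff_0 zero_neq_one)
    ultimately show thesis using that by blast
  qed
qed

lemma summable_of_contraction:
  fixes f g :: "nat \<Rightarrow> real"
  assumes "\<And>k. 0 \<le> f k" "\<And>k. 0 \<le> g k" "\<And>k. f (Suc k) \<le> c * f k + g k"
    and "c < 1" "summable g"
  shows "summable f"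
proof (rule summableI_nonneg_bounded)
  fix n
  have "sum f {..<n} \<le> (f 0 + suminf g) / (1 - c)"
  proof -
    have "sum f {..<n} \<le> f 0 + sum (\<lambda>k. f (Suc k)) {..<n}"
      using assms(1)[of n] sum.lessThan_Suc_shift[of f n] by simp
    also have "\<dots> \<le> f 0 + (c * sum f {..<n} + sum g {..<n})"
      using sum_mono[of "{..<n}" "\<lambda>k. f (Suc k)" "\<lambda>k. c * f k + g k"] assms(3)
      by (simp add: sum.distrib sum_distrib_left)
    also have "sum g {..<n} \<le> suminf g"
      using assms by (intro sum_le_suminf) auto
    finally show ?thesis
      using assms(4) by (simp add: field_simps)
  qed
  then show "sum f {..<n} \<le> (f 0 + suminf g) / (1 - c)" .
qed (use assms in auto)

lemma norm_scale_complex: "norm (c *s v) = cmod c * norm v" for v :: "complex^'n"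
  by (simp add: norm_vec_def L2_set_def norm_mult power_mult_distrib
      sum_distrib_left[symmetric] real_sqrt_mult)

text \<open>Induction on the degree of an annihilating polynomial. A root \<open>l\<close> that is an eigenvalue
  satisfies \<open>cmod l < 1\<close>, so summability passes from the orbit of \<open>M v - l v\<close> to that of \<open>v\<close>;
  for any other root, the factor can be cancelled.\<close>

lemma summable_orbit_of_annihilating_poly:
  fixes M :: "complex^'n^'n"
  assumes "\<And>l. is_eigenval M l \<Longrightarrow> cmod l < 1"
  shows "p \<noteq> 0 \<Longrightarrow> poly_mv p M v = 0 \<Longrightarrow> summable (\<lambda>k. norm (((*v) M ^^ k) v))"
proof (induction "degree p" arbitrary: p v)
  case 0
  then obtain c where "p = [:c:]" "c \<noteq> 0"
    by (metis degree_eq_zeroE pCons_eq_0_iff)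
  with 0 have "v = 0" by simp
  then have "((*v) M ^^ k) v = 0" for k by (induction k) simp_all
  then show ?case by simp
next
  case (Suc n)
  then obtain l where "poly p l = 0"
    using fundamental_theorem_of_algebra[of p] constant_degree[of p] by auto
  then obtain q where p: "p = [:- l, 1:] * q"
    by (auto simp: poly_eq_0_iff_dvd elim: dvdE)
  with Suc.prems have "q \<noteq> 0" by auto
  then have deg: "n = degree q"
  proof -
    have "degree p = degree [:- l, 1:] + degree q"
      unfolding p by (rule degree_mult_eq) (use \<open>q \<noteq> 0\<close> in auto)
    moreover have "degree [:- l, 1:] = 1" by simp
    ultimately show ?thesis using Suc.hyps(2) by linarith
  qed
  have fac: "M *v poly_mv q M v = l *s poly_mv q M v"
    using Suc.prems(2) unfolding p poly_mv_linear_factor by simp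
  show ?case
  proof (cases "is_eigenval M l")
    case True
    define u where "u = M *v v - l *s v"
    have "poly_mv q M u = 0"
      by (simp add: u_def poly_mv_diff_vec poly_mv_scale poly_mv_apply[symmetric] fac)
    then have sum_u: "summable (\<lambda>k. norm (((*v) M ^^ k) u))"
      by (intro Suc.hyps(1)[OF deg \<open>q \<noteq> 0\<close>])
    have orbit: "((*v) M ^^ Suc k) v = l *s ((*v) M ^^ k) v + ((*v) M ^^ k) u" for k
      by (induction k)
         (simp_all add: u_def matrix_vector_right_distrib vector_scalar_commute)
    show ?thesis
    proof (rule summable_of_contraction[OF _ _ _ assms[OF True] sum_u])
      fix k
      show "norm (((*v) M ^^ Suc k) v) \<le>
          cmod l * norm (((*v) M ^^ k) v) + norm (((*v) M ^^ k) u)"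
        unfolding orbit by (metis norm_scale_complex norm_triangle_ineq)
    qed auto
  next
    case False
    with fac have "poly_mv q M v = 0"
      unfolding is_eigenval_def by blast
    then show ?thesis
      by (intro Suc.hyps(1)[OF deg \<open>q \<noteq> 0\<close>])
  qed
qed

lemma schur_stable_summable_orbit:
  fixes M :: "real^'n^'n"
  assumes "schur_stable M"
  shows "summable (\<lambda>k. norm (((*v) M ^^ k) x))"
proof -
  let ?M = "map_matrix complex_of_real M" and ?c = "\<lambda>v::real^'n. \<chi> i. complex_of_real (v $ i)"
  have "?M *v ?c v = ?c (M *v v)" for v
    by (simp add: vec_eq_iff matrix_vector_mult_def map_matrix_def)
  then have "((*v) ?M ^^ k) (?c x) = ?c (((*v) M ^^ k) x)" for k
    by (induction k) simp_all
  moreover have "norm (?c v) = norm v" for v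
    by (simp add: norm_vec_def)
  moreover obtain p where "p \<noteq> 0" "poly_mv p ?M (?c x) = 0"
    by (rule annihilating_poly)
  then have "summable (\<lambda>k. norm (((*v) ?M ^^ k) (?c x)))"
    using assms unfolding schur_stable_def by (intro summable_orbit_of_annihilating_poly) auto
  ultimately show ?thesis by simp
qed

section \<open>The algebraic Riccati equation\<close>

lemma riccati_iterates_contract:
  assumes R: "\<And>k. k < N \<Longrightarrow> pos_def (R k)" and XY: "\<And>k. k \<le> N \<Longrightarrow> psd (X k)" "\<And>k. k \<le> N \<Longrightarrow> psd (Y k)"
    and X: "\<And>k. k < N \<Longrightarrow> X (Suc k) = riccati_F A B (Q k) (R k) (X k)"
    and Y: "\<And>k. k < N \<Longrightarrow> Y (Suc k) = riccati_F A B (Q k) (R k) (Y k)"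
    and q: "q > 0" "\<And>k x. k < N \<Longrightarrow> q * (norm x)\<^sup>2 \<le> quad (Q k) x"
    and a: "a \<ge> 0" "\<And>k x. k < N \<Longrightarrow> quad (X k) (A *v x) \<le> a * (norm x)\<^sup>2"
    and e: "e \<ge> 0" "\<And>x. quad (Y 0) x \<le> (1 + e) * quad (X 0) x"
  shows "k \<le> N \<Longrightarrow> quad (Y k) x \<le> (1 + (a / (q + a)) ^ k * e) * quad (X k) x"
proof (induction k arbitrary: x)
  case 0
  with e show ?case by simp
next
  case (Suc k)
  then have k: "k < N" "k \<le> N" by auto
  have "quad (Y (Suc k)) x \<le> (1 + a / (q + a) * ((a / (q + a)) ^ k * e)) * quad (X (Suc k)) x"
    unfolding X[OF k(1)] Y[OF k(1)]
    using Suc.IH[OF k(2)] q a e k XY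
    by (intro riccati_F_contraction R) auto
  then show ?case by (simp add: mult.assoc)
qed

lemma le_of_geometric_slack:
  fixes a b :: real
  assumes "0 \<le> c" "c < 1" "\<And>k. a \<le> (1 + c ^ k * e) * b"
  shows "a \<le> b"
proof (rule LIMSEQ_le_const)
  have "(\<lambda>k. (1 + c ^ k * e) * b) \<longlonglongrightarrow> (1 + 0 * e) * b"
    by (intro tendsto_intros LIMSEQ_power_zero) (use assms in auto)
  then show "(\<lambda>k. (1 + c ^ k * e) * b) \<longlonglongrightarrow> b" by simp
qed (use assms in auto)

lemma quad_le_multiple:
  assumes "q > 0" "\<And>x. q * (norm x)\<^sup>2 \<le> quad M x"
  shows "quad N x \<le> (1 + opnorm N / q) * quad M x"
proof -
  have "quad N x \<le> opnorm N / q * (q * (norm x)\<^sup>2)"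
    using quad_le_opnorm[of N x] assms(1) by simp
  also have "\<dots> \<le> opnorm N / q * quad M x"
    using assms(1) opnorm_nonneg[of N] by (intro mult_left_mono assms(2)) auto
  finally show ?thesis
    using assms(2)[of x] order_trans[OF mult_nonneg_nonneg[of q "(norm x)\<^sup>2"] assms(2)[of x]] assms(1)
    by (simp add: algebra_simps)
qed

lemma opnorm_quad_apply_le: "quad P (A *v x) \<le> opnorm P * (opnorm A)\<^sup>2 * (norm x)\<^sup>2"
proof -
  have "quad P (A *v x) \<le> opnorm P * (norm (A *v x))\<^sup>2"
    using quad_le_opnorm[of P "A *v x"] by simp
  also have "\<dots> \<le> opnorm P * (opnorm A * norm x)\<^sup>2"
    by (intro mult_left_mono power_mono norm_le_opnorm opnorm_nonneg norm_ge_zero)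
  finally show ?thesis by (simp add: power_mult_distrib ac_simps)
qed

lemma pos_def_quad_lower_bound:
  assumes "pos_def Q"
  obtains q where "q > 0" "\<And>x. q * (norm x)\<^sup>2 \<le> quad Q x"
  using lambda_min_pos[OF assms] lambda_min_le_quad[of Q] assms
  unfolding pos_def_def by blast

text \<open>Two solutions are comparable up to a factor, which the contraction reduces to one.\<close>

lemma dare_unique:
  assumes Q: "pos_def Q" and R: "pos_def R"
    and P: "pos_def P" "P = riccati_F A B Q R P"
    and P': "pos_def P'" "P' = riccati_F A B Q R P'"
  shows "P = P'"
proof -
  obtain q where q: "q > 0" "\<And>x. q * (norm x)\<^sup>2 \<le> quad Q x"
    using pos_def_quad_lower_bound[OF Q] by blast
  have le: "quad P2 x \<le> quad P1 x"
    if P1: "pos_def P1" "P1 = riccati_F A B Q R P1" and P2: "pos_def P2" "P2 = riccati_F A B Q R P2"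
    for P1 P2 x
  proof -
    have psd: "psd P1" "psd P2"
      using P1 P2 by (auto intro: pos_def_imp_psd)
    have "q * (norm x)\<^sup>2 \<le> quad P1 x" for x
      using q(2)[of x] riccati_F_ge[OF R psd(1), of Q x A B] P1(2) by simp
    note bound = quad_le_multiple[OF q(1) this]
    define a where "a = opnorm P1 * (opnorm A)\<^sup>2"
    have a: "a \<ge> 0" by (simp add: a_def opnorm_nonneg)
    have "quad P2 x \<le> (1 + (a / (q + a)) ^ k * (opnorm P2 / q)) * quad P1 x" for k
      by (rule riccati_iterates_contract[where N = k and R = "\<lambda>_. R" and Q = "\<lambda>_. Q"
            and X = "\<lambda>_. P1" and Y = "\<lambda>_. P2" and A = A and B = B])
         (use q a R psd P1 P2 bound opnorm_nonneg[of P2] in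
           \<open>auto simp: a_def intro: opnorm_quad_apply_le\<close>)
    then show ?thesis
      by (rule le_of_geometric_slack[rotated 2]) (use q a in \<open>auto simp: field_simps\<close>)
  qed
  show ?thesis
    by (intro quad_eqI antisym le[OF P P'] le[OF P' P])
       (use P(1) P'(1) in \<open>auto simp: pos_def_def\<close>)
qed

text \<open>Value iteration from \<open>0\<close>: the forms of \<open>F\<^sup>k(0)\<close> increase, and they are bounded by the
  cost of a stabilizing feedback, whose closed-loop orbits are summable. The limit \<open>P\<close> satisfies
  \<open>P \<le> F(P)\<close> by monotonicity. The converse follows from the contraction:
  \<open>F(P) \<le> F\<^sup>k(P)\<close>, which is at most a factor tending to one times
  \<open>F\<^sup>k\<^sup>+\<^sup>1(0) \<le> P\<close>.\<close>

lemma dare_exists: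
  fixes A :: "real^'n^'n" and B :: "real^'u^'n"
  assumes Q: "pos_def Q" and R: "pos_def R" and "stabilizable A B"
  shows "\<exists>P. pos_def P \<and> P = riccati_F A B Q R P"
proof -
  let ?F = "riccati_F A B Q R"
  obtain q where q: "q > 0" "\<And>x. q * (norm x)\<^sup>2 \<le> quad Q x"
    using pos_def_quad_lower_bound[OF Q] by blast
  have psdQ: "psd Q" using Q by (rule pos_def_imp_psd)
  have mono: "quad (?F P) x \<le> quad (?F P') x"
    if "psd P" "psd P'" "\<And>x. quad P x \<le> quad P' x" for P P' x
    using that by (intro riccati_F_mono R) auto
  define X where "X k = (?F ^^ k) 0" for k
  have X_Suc: "X (Suc k) = ?F (X k)" for k by (simp add: X_def)
  have psdX: "psd (X k)" for k
  proof (induction k)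
    case 0
    show ?case by (simp add: X_def psd_def sym_mat_def quad_def transpose_def vec_eq_iff)
  next
    case (Suc k)
    then show ?case unfolding X_Suc by (intro psd_riccati_F R psdQ)
  qed
  have symX: "sym_mat (X k)" for k using psdX by (simp add: psd_def)
  have X_le_Suc: "quad (X k) x \<le> quad (X (Suc k)) x" for k x
  proof (induction k arbitrary: x)
    case 0
    show ?case
      using psdX[of "Suc 0"] by (simp add: X_def psd_def quad_def)
  next
    case (Suc k)
    then show ?case unfolding X_Suc[of "Suc k"] X_Suc[of k]
      by (intro mono) (use psdX X_Suc in metis)+
  qed
  obtain K where K: "schur_stable (A - B ** K)"
    using assms(3) unfolding stabilizable_def by blast
  define M where "M = A - B ** K"
  define s where "s = opnorm Q + opnorm R * (opnorm K)\<^sup>2"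
  have X_step: "quad (X (Suc k)) x \<le> s * (norm x)\<^sup>2 + quad (X k) (M *v x)" for k x
  proof -
    have "quad (X (Suc k)) x \<le> quad Q x + quad R ((- K) *v x) + quad (X k) (A *v x + B *v ((- K) *v x))"
      unfolding X_Suc by (rule quad_riccati_F_le[OF R psdX])
    moreover have "quad Q x \<le> opnorm Q * (norm x)\<^sup>2"
      using quad_le_opnorm[of Q x] by simp
    moreover have "quad R ((- K) *v x) \<le> opnorm R * (opnorm K)\<^sup>2 * (norm x)\<^sup>2"
      using opnorm_quad_apply_le[of R "- K" x] by (simp add: opnorm_minus)
    moreover have "A *v x + B *v ((- K) *v x) = M *v x"
    proof -
      have "(- K) *v x = - (K *v x)"
        using matrix_vector_mult_diff_rdistrib[of 0 K x] by simp
      then show ?thesis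
        using matrix_vector_mult_diff_distrib[of B 0 "K *v x"]
        by (simp add: M_def matrix_vector_mult_diff_rdistrib matrix_vector_mul_assoc)
    qed
    ultimately show ?thesis by (simp add: s_def algebra_simps)
  qed
  have s: "s \<ge> 0" by (simp add: s_def opnorm_nonneg)
  have "quad (X k) x \<le> s * (\<Sum>j<k. (norm (((*v) M ^^ j) x))\<^sup>2)" for k x
  proof (induction k arbitrary: x)
    case 0
    show ?case by (simp add: X_def quad_def)
  next
    case (Suc k)
    have "quad (X (Suc k)) x \<le>
        s * (norm x)\<^sup>2 + s * (\<Sum>j<k. (norm (((*v) M ^^ j) (M *v x)))\<^sup>2)"
      using X_step[of k x] Suc.IH[of "M *v x"] by simp
    also have "\<dots> = s * (\<Sum>j<Suc k. (norm (((*v) M ^^ j) x))\<^sup>2)"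
      by (simp only: sum.lessThan_Suc_shift)
         (simp add: funpow_swap1[of "(*v) M", symmetric] distrib_left)
    finally show ?case .
  qed
  moreover have "(\<Sum>j<k. (norm (((*v) M ^^ j) x))\<^sup>2) \<le> (\<Sum>j. norm (((*v) M ^^ j) x))\<^sup>2" for k x
  proof -
    let ?f = "\<lambda>j. norm (((*v) M ^^ j) x)"
    have sf: "summable ?f"
      unfolding M_def by (rule schur_stable_summable_orbit[OF K])
    have "?f j \<le> suminf ?f" for j
      using sum_le_suminf[OF sf, of "{j}"] by simp
    then have "(\<Sum>j<k. (?f j)\<^sup>2) \<le> (\<Sum>j<k. suminf ?f * ?f j)"
      by (intro sum_mono) (simp add: power2_eq_square mult_right_mono)
    also have "\<dots> \<le> suminf ?f * suminf ?f"
      unfolding sum_distrib_left[symmetric]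
      by (intro mult_left_mono sum_le_suminf sf suminf_nonneg) auto
    finally show ?thesis by (simp add: power2_eq_square)
  qed
  ultimately have X_bound: "quad (X k) x \<le> s * (\<Sum>j. norm (((*v) M ^^ j) x))\<^sup>2" for k x
    using s by (meson mult_left_mono order_trans)
  have conv_quad: "convergent (\<lambda>k. quad (X k) x)" for x
  proof -
    have "incseq (\<lambda>k. quad (X k) x)"
      by (rule incseq_SucI) (rule X_le_Suc)
    with X_bound show ?thesis
      by (meson convergentI incseq_convergent)
  qed
  have entry: "N $ i $ j = axis i 1 \<bullet> (N *v axis j 1)" for N :: "real^'n^'n" and i j
    by (simp add: inner_axis' matrix_vector_mul_component inner_axis)
  have conv_entry: "convergent (\<lambda>k. X k $ i $ j)" for i j
  proof -
    have "X k $ i $ j =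
        1 / 4 * (quad (X k) (axis i 1 + axis j 1) - quad (X k) (axis i 1 - axis j 1))" for k
      unfolding entry quad_polarization[OF symX, symmetric] by simp
    then have eq: "(\<lambda>k. X k $ i $ j) =
        (\<lambda>k. 1 / 4 * (quad (X k) (axis i 1 + axis j 1) - quad (X k) (axis i 1 - axis j 1)))"
      by (rule ext)
    show ?thesis
      unfolding eq by (intro convergent_mult convergent_diff conv_quad convergent_const)
  qed
  define P where "P = (\<chi> i j. lim (\<lambda>k. X k $ i $ j))"
  have "X \<longlonglongrightarrow> P"
    by (intro vec_tendstoI) (use conv_entry in \<open>simp add: P_def convergent_LIMSEQ_iff\<close>)
  then have X_lim: "(\<lambda>k. quad (X k) x) \<longlonglongrightarrow> quad P x" for x
    unfolding quad_def inner_vec_def matrix_vector_mult_def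
    by (intro tendsto_intros) (auto intro!: tendsto_intros)
  have X_le_P: "quad (X k) x \<le> quad P x" for k x
    by (rule incseq_le[OF incseq_SucI X_lim]) (rule X_le_Suc)
  have X_ge: "q * (norm x)\<^sup>2 \<le> quad (X (Suc k)) x" for k x
    using q(2)[of x] riccati_F_ge[OF R psdX, of Q x A B k] X_Suc by (metis order_trans)
  have "P $ i $ j = P $ j $ i" for i j
    using symX unfolding P_def sym_mat_def by (simp add: transpose_def vec_eq_iff)
  then have symP: "sym_mat P"
    by (simp add: sym_mat_def transpose_def vec_eq_iff)
  have P_ge: "q * (norm x)\<^sup>2 \<le> quad P x" for x
    using X_ge[of x 0] X_le_P[of "Suc 0" x] by simp
  have "quad P x > 0" if "x \<noteq> 0" for x
    using P_ge[of x] q(1) that by (smt (verit) mult_pos_pos zero_less_norm_iff zero_less_power)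
  then have posP: "pos_def P"
    using symP by (simp add: pos_def_iff_quad)
  then have psdP: "psd P" by (rule pos_def_imp_psd)
  have P_le: "quad P x \<le> quad (?F P) x" for x
  proof (rule LIMSEQ_le_const2[OF X_lim])
    have "quad (X (Suc k)) x \<le> quad (?F P) x" for k
      unfolding X_Suc by (intro mono psdX psdP X_le_P)
    then show "\<exists>N. \<forall>n\<ge>N. quad (X n) x \<le> quad (?F P) x"
      by (metis Suc_le_D)
  qed
  define Y where "Y k = (?F ^^ k) P" for k
  have Y_Suc: "Y (Suc k) = ?F (Y k)" for k by (simp add: Y_def)
  have psdY: "psd (Y k)" for k
    by (induction k) (auto simp: Y_def intro!: psdP psd_riccati_F R psdQ)
  have Y_ge: "quad (?F P) x \<le> quad (Y (Suc k)) x" for k x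
  proof (induction k arbitrary: x)
    case 0
    show ?case by (simp add: Y_def)
  next
    case (Suc k)
    have "quad P x \<le> quad (Y (Suc k)) x" for x
      using P_le[of x] Suc.IH[of x] by simp
    then show ?case
      unfolding Y_Suc[of "Suc k"] by (intro mono psdP psdY)
  qed
  define a where "a = opnorm P * (opnorm A)\<^sup>2"
  have a: "a \<ge> 0" by (simp add: a_def opnorm_nonneg)
  have X_a: "quad (X k) (A *v x) \<le> a * (norm x)\<^sup>2" for k x
    using X_le_P[of k "A *v x"] opnorm_quad_apply_le[of P A x] by (simp add: a_def)
  have Y_le: "quad (Y k) x \<le> (1 + (a / (q + a)) ^ k * (opnorm P / q)) * quad (X (Suc k)) x" for k x
  proof (rule riccati_iterates_contract[where N = k and R = "\<lambda>_. R" and Q = "\<lambda>_. Q"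
          and X = "\<lambda>k. X (Suc k)" and Y = Y and A = A and B = B])
    show "quad (Y 0) x \<le> (1 + opnorm P / q) * quad (X (Suc 0)) x" for x
      unfolding Y_def using quad_le_multiple[OF q(1) X_ge] by simp
  qed (use q a X_a[of "Suc _"] R psdX[of "Suc _"] psdY X_Suc Y_Suc opnorm_nonneg[of P] in auto)
  have FP_le: "quad (?F P) x \<le> quad P x" for x
  proof (rule le_of_geometric_slack)
    fix k
    let ?c = "a / (q + a)"
    have c: "0 \<le> ?c" "?c \<le> 1" using q a by (auto simp: field_simps)
    have "quad (?F P) x \<le> (1 + ?c ^ Suc k * (opnorm P / q)) * quad (X (Suc (Suc k))) x"
      using Y_ge[of x k] Y_le[of "Suc k" x] by (rule order_trans)
    also have "\<dots> \<le> (1 + ?c ^ k * (opnorm P / q)) * quad P x"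
      using c q opnorm_nonneg[of P] psdX[of "Suc (Suc k)"]
      by (intro mult_mono X_le_P add_mono order_refl mult_right_mono power_decreasing)
         (auto simp: psd_def)
    finally show "quad (?F P) x \<le> (1 + ?c ^ k * (opnorm P / q)) * quad P x" .
  qed (use q a in \<open>auto simp: field_simps\<close>)
  have "P = ?F P"
    using symP psd_riccati_F[OF R psdP psdQ, of A B] P_le FP_le
    by (intro quad_eqI antisym) (auto simp: psd_def)
  with posP show ?thesis by blast
qed

lemma dare_sol_properties:
  assumes "pos_def Q" "pos_def R" "stabilizable A B"
  shows "pos_def (dare_sol A B Q R)"
    and "riccati_F A B Q R (dare_sol A B Q R) = dare_sol A B Q R"
proof -
  have "\<exists>!P. pos_def P \<and> P = riccati_F A B Q R P"
    using dare_exists[OF assms] dare_unique[OF assms(1,2)] by metis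
  from theI'[OF this]
  show "pos_def (dare_sol A B Q R)" "riccati_F A B Q R (dare_sol A B Q R) = dare_sol A B Q R"
    unfolding dare_sol_def by auto
qed

section \<open>Riccati recursions below a supersolution\<close>

lemma riccati_rec_end [simp]: "riccati_rec A B Q R S e e = S"
  by (simp add: riccati_rec.simps)

lemma riccati_rec_step:
  "t < e \<Longrightarrow> riccati_rec A B Q R S e t = riccati_F A B (Q t) (R t) (riccati_rec A B Q R S e (Suc t))"
  by (subst riccati_rec.simps) simp

lemma riccati_rec_restart:
  assumes "t \<le> e" "e \<le> e'"
  shows "riccati_rec A B Q R S e' t = riccati_rec A B Q R (riccati_rec A B Q R S e' e) e t"
  using assms(1)
proof (induction rule: inc_induct)
  case (step t)
  then show ?case
    using assms(2) by (simp add: riccati_rec_step)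
qed simp

lemma transition_same [simp]: "transition A B K t t = mat 1"
  by (cases t) auto

lemma transition_rightmost:
  "s < t \<Longrightarrow> transition A B K t s = transition A B K t (Suc s) ** (A - B ** K s)"
proof (induction t)
  case (Suc t)
  show ?case
  proof (cases "s = t")
    case False
    with Suc show ?thesis by (simp add: matrix_mul_assoc)
  qed simp
qed simp

text \<open>Two products of closed-loop matrices differ by a telescoping sum, in which each term has
  one factor replaced by the difference of the gains.\<close>

lemma transition_diff:
  "transition A B K' t s *v x - transition A B K t s *v x =
    (\<Sum>l = s..<t. transition A B K' t (Suc l) *v (B *v ((K l - K' l) *v (transition A B K l s *v x))))"
  (is "?D t = (\<Sum>l = s..<t. ?f t l)")
proof (induction t)
  case (Suc t)
  show ?case
  proof (cases "s \<le> t")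
    case True
    have "?D (Suc t) = (A - B ** K' t) *v ?D t + B *v ((K t - K' t) *v (transition A B K t s *v x))"
      using True by (simp add: matrix_vector_mul_assoc[symmetric] algebra_simps)
    also have "(A - B ** K' t) *v ?D t = (\<Sum>l = s..<t. (A - B ** K' t) *v ?f t l)"
      unfolding Suc.IH by (rule linear_sum) (rule matrix_vector_mul_linear)
    also have "\<dots> = (\<Sum>l = s..<t. ?f (Suc t) l)"
      by (intro sum.cong) (auto simp: matrix_vector_mul_assoc matrix_mul_assoc)
    finally show ?thesis
      using True by simp
  qed simp
qed simp

text \<open>In the following setting \<open>Pm\<close> is a supersolution of all Riccati equations that occur,
  and the stage costs are bounded from below. Then every Riccati recursion started from a matrix
  between \<open>q I\<close> and \<open>Pm\<close> stays between these bounds.\<close>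

locale lq_horizon =
  fixes A :: "real^'n^'n" and B :: "real^'u^'n"
    and Q :: "nat \<Rightarrow> real^'n^'n" and R :: "nat \<Rightarrow> real^'u^'u" and T :: nat
    and Pm :: "real^'n^'n" and q p r rm a :: real
  assumes q_pos: "0 < q" and r_pos: "0 < r" and a_nonneg: "0 \<le> a" and T_pos: "1 \<le> T"
    and psd_Q: "t \<in> {1..T} \<Longrightarrow> psd (Q t)"
    and Q_ge: "t \<in> {1..T} \<Longrightarrow> q * (norm x)\<^sup>2 \<le> quad (Q t) x"
    and Q_le: "t \<in> {1..T} \<Longrightarrow> quad (Q t) x \<le> quad Pm x"
    and pos_def_R: "t \<in> {1..<T} \<Longrightarrow> pos_def (R t)"
    and R_ge: "t \<in> {1..<T} \<Longrightarrow> r * (norm u)\<^sup>2 \<le> quad (R t) u"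
    and R_le: "t \<in> {1..<T} \<Longrightarrow> quad (R t) u \<le> rm * (norm u)\<^sup>2" and rm_nonneg: "0 \<le> rm"
    and psd_Pm: "psd Pm"
    and Pm_super: "t \<in> {1..<T} \<Longrightarrow> quad (riccati_F A B (Q t) (R t) Pm) x \<le> quad Pm x"
    and Pm_le: "quad Pm x \<le> p * (norm x)\<^sup>2"
    and Pm_A_le: "quad Pm (A *v x) \<le> a * (norm x)\<^sup>2"
begin

definition adm :: "real^'n^'n \<Rightarrow> bool" where
  "adm S \<longleftrightarrow> psd S \<and> (\<forall>x. q * (norm x)\<^sup>2 \<le> quad S x) \<and> (\<forall>x. quad S x \<le> quad Pm x)"

definition \<rho> :: real where "\<rho> = sqrt (1 - q / p)"

definition \<gamma> :: real where "\<gamma> = a / (q + a)"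

abbreviation rc :: "real^'n^'n \<Rightarrow> nat \<Rightarrow> nat \<Rightarrow> real^'n^'n" where
  "rc \<equiv> riccati_rec A B Q R"

abbreviation K :: "real^'n^'n \<Rightarrow> nat \<Rightarrow> nat \<Rightarrow> real^'n^'u" where
  "K S e \<equiv> gain A B R (rc S e)"

abbreviation \<Phi> :: "real^'n^'n \<Rightarrow> nat \<Rightarrow> nat \<Rightarrow> nat \<Rightarrow> real^'n^'n" where
  "\<Phi> S e \<equiv> transition A B (K S e)"

abbreviation Hi :: "real^'n^'n \<Rightarrow> nat \<Rightarrow> nat \<Rightarrow> real^'u^'u" where
  "Hi S e t \<equiv> matrix_inv (lq_hess B (R t) (rc S e (Suc t)))"

lemma q_le_p: "q \<le> p"
proof -
  obtain v :: "real^'n" where v: "norm v = 1"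
    by (metis norm_axis_1)
  show ?thesis
    using order_trans[OF order_trans[OF Q_ge[of 1 v] Q_le[of 1 v]] Pm_le] v T_pos by simp
qed

lemma p_pos: "0 < p"
  using q_le_p q_pos by simp

lemma \<rho>_bounds: "0 \<le> \<rho>" "\<rho> < 1"
  using q_le_p q_pos p_pos by (auto simp: \<rho>_def)

lemma \<rho>_squared: "\<rho>\<^sup>2 = 1 - q / p"
  using q_le_p p_pos by (simp add: \<rho>_def)

lemma \<gamma>_bounds: "0 \<le> \<gamma>" "\<gamma> < 1"
  using q_pos a_nonneg by (auto simp: \<gamma>_def)

lemma adm_psd: "adm S \<Longrightarrow> psd S"
  and adm_ge: "adm S \<Longrightarrow> q * (norm x)\<^sup>2 \<le> quad S x"
  and adm_le_Pm: "adm S \<Longrightarrow> quad S x \<le> quad Pm x"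
  by (auto simp: adm_def)

lemma adm_le: "adm S \<Longrightarrow> quad S x \<le> p * (norm x)\<^sup>2"
  using adm_le_Pm Pm_le order_trans by blast

lemma adm_Q: "t \<in> {1..T} \<Longrightarrow> adm (Q t)"
  by (simp add: adm_def psd_Q Q_ge Q_le)

lemma adm_Pm: "adm Pm"
  using adm_Q[of 1] T_pos psd_Pm unfolding adm_def by (auto intro: order_trans)

lemma opnorm_adm_le: "adm S \<Longrightarrow> opnorm S \<le> p"
  using p_pos by (intro opnorm_le_of_quad adm_psd adm_le) auto

lemma adm_riccati_F:
  assumes S: "adm S" and t: "t \<in> {1..<T}"
  shows "adm (riccati_F A B (Q t) (R t) S)"
proof -
  have t': "t \<in> {1..T}" using t by simp
  note R = pos_def_R[OF t]
  have "quad (riccati_F A B (Q t) (R t) S) x \<le> quad Pm x" for x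
    using riccati_F_mono[OF R R adm_psd[OF S] psd_Pm order_refl order_refl adm_le_Pm[OF S], of A B "Q t" x]
      Pm_super[OF t, of x] by simp
  moreover have "q * (norm x)\<^sup>2 \<le> quad (riccati_F A B (Q t) (R t) S) x" for x
    using Q_ge[OF t', of x] riccati_F_ge[OF R adm_psd[OF S], of "Q t" x A B] by simp
  ultimately show ?thesis
    using psd_riccati_F[OF R adm_psd[OF S] psd_Q[OF t']] by (simp add: adm_def)
qed

lemma adm_rc:
  assumes "adm S" "e \<le> T" "1 \<le> t"
  shows "adm (rc S e t)"
proof (cases "t \<le> e")
  case True
  then show ?thesis
  proof (induction rule: inc_induct)
    case (step n)
    then show ?case
      using assms(2,3) True by (auto simp: riccati_rec_step intro!: adm_riccati_F)
  qed (simp add: assms)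
next
  case False
  with assms(1) show ?thesis by (simp add: riccati_rec.simps)
qed

lemma rc_mono:
  assumes "adm S" "adm S'" "e \<le> T" "1 \<le> t" "t \<le> e" "\<And>x. quad S x \<le> quad S' x"
  shows "quad (rc S e t) x \<le> quad (rc S' e t) x"
  using \<open>t \<le> e\<close>
proof (induction arbitrary: x rule: inc_induct)
  case base
  show ?case using assms(6) by simp
next
  case (step n)
  then have "n \<in> {1..<T}" using assms by auto
  then show ?case
    using step assms
    by (simp only: riccati_rec_step) (intro riccati_F_mono pos_def_R adm_psd adm_rc; simp)
qed

lemma opnorm_Hi_le:
  assumes "adm S" "e \<le> T" "t \<in> {1..<T}"
  shows "opnorm (Hi S e t) \<le> 1 / r"
proof (rule opnorm_inverse_le)
  have psd: "psd (rc S e (Suc t))"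
    using assms by (intro adm_psd adm_rc) auto
  then show "pos_def (lq_hess B (R t) (rc S e (Suc t)))"
    using assms by (intro pos_def_lq_hess pos_def_R)
  show "r * (norm x)\<^sup>2 \<le> quad (lq_hess B (R t) (rc S e (Suc t))) x" for x
    using R_ge[OF assms(3), of x] psd by (simp add: quad_lq_hess psd_def add_increasing2)
qed (rule r_pos)

text \<open>One optimal step consumes at least \<open>q\<close> times the squared norm of \<open>x\<close>, which is at least the
  fraction \<open>q / p\<close> of the cost to go. So the cost to go is a Lyapunov function with rate
  \<open>\<rho>\<^sup>2 = 1 - q / p\<close>.\<close>

lemma closed_loop_step:
  assumes "adm S" "e \<le> T" "1 \<le> t" "t < e"
  shows "quad (rc S e (Suc t)) ((A - B ** K S e t) *v x) \<le> \<rho>\<^sup>2 * quad (rc S e t) x"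
proof -
  have t: "t \<in> {1..<T}" "t \<in> {1..T}" using assms by auto
  have psd: "psd (rc S e (Suc t))"
    using assms by (intro adm_psd adm_rc) auto
  have adm: "adm (rc S e t)"
    using assms by (intro adm_rc) auto
  have "quad (rc S e t) x = quad (Q t) x + quad (R t) (- (K S e t *v x))
      + quad (rc S e (Suc t)) ((A - B ** K S e t) *v x)"
    using quad_riccati_F_gain[OF pos_def_R[OF t(1)] psd, of A B "Q t" x] assms(4)
    by (simp add: riccati_rec_step gain_eq_lq_gain)
  moreover have "0 \<le> quad (R t) (- (K S e t *v x))"
    using pos_def_imp_psd[OF pos_def_R[OF t(1)]] by (simp add: psd_def)
  moreover have "q / p * quad (rc S e t) x \<le> quad (Q t) x"
  proof -
    have "q / p * quad (rc S e t) x \<le> q / p * (p * (norm x)\<^sup>2)"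
      using q_pos p_pos adm_le[OF adm] by (intro mult_left_mono) auto
    then show ?thesis
      using Q_ge[OF t(2), of x] p_pos by simp
  qed
  ultimately show ?thesis
    by (simp add: \<rho>_squared algebra_simps)
qed

lemma closed_loop_decay:
  assumes "adm S" "e \<le> T" "1 \<le> s" "s \<le> t" "t \<le> e"
  shows "quad (rc S e t) (\<Phi> S e t s *v x) \<le> (\<rho> ^ (t - s))\<^sup>2 * quad (rc S e s) x"
  using \<open>s \<le> t\<close> \<open>t \<le> e\<close>
proof (induction rule: dec_induct)
  case (step n)
  then have "quad (rc S e (Suc n)) (\<Phi> S e (Suc n) s *v x) \<le> \<rho>\<^sup>2 * quad (rc S e n) (\<Phi> S e n s *v x)"
    using closed_loop_step[of S e n] assms by (simp add: matrix_vector_mul_assoc[symmetric])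
  also have "\<dots> \<le> \<rho>\<^sup>2 * ((\<rho> ^ (n - s))\<^sup>2 * quad (rc S e s) x)"
    using step by (intro mult_left_mono) auto
  finally show ?case
    using step by (simp add: Suc_diff_le power_mult_distrib)
qed simp

text \<open>The price for passing from the Lyapunov form to the Euclidean norm and back.\<close>

definition C :: real where "C = sqrt (p / q)"

lemma C_nonneg: "0 \<le> C"
  using q_pos p_pos by (simp add: C_def)

lemma norm_le_of_quad_le:
  assumes "adm S" "adm S'" "0 \<le> c" "quad S' y \<le> c\<^sup>2 * quad S x"
  shows "norm y \<le> C * c * norm x"
proof -
  have "q * (norm y)\<^sup>2 \<le> c\<^sup>2 * (p * (norm x)\<^sup>2)"
    using adm_ge[OF assms(2), of y] assms(4) mult_left_mono[OF adm_le[OF assms(1), of x], of "c\<^sup>2"]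
    by simp
  then have "(norm y)\<^sup>2 \<le> (C * c * norm x)\<^sup>2"
    using q_pos p_pos by (simp add: C_def power_mult_distrib field_simps)
  then show ?thesis
    using C_nonneg assms(3) by (simp add: power2_le_iff_abs_le abs_mult)
qed

lemma opnorm_\<Phi>_le:
  assumes "adm S" "e \<le> T" "1 \<le> s" "s \<le> t" "t \<le> e"
  shows "opnorm (\<Phi> S e t s) \<le> C * \<rho> ^ (t - s)"
  using assms \<rho>_bounds
  by (intro opnorm_le norm_le_of_quad_le[OF _ _ _ closed_loop_decay[OF assms]] adm_rc) auto

lemma opnorm_closed_loop_le:
  assumes "adm S" "e \<le> T" "1 \<le> t" "t < e"
  shows "opnorm (A - B ** K S e t) \<le> C * \<rho>"
  using opnorm_\<Phi>_le[of S e t "Suc t"] assms by simp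

section \<open>Sensitivity to the terminal matrix\<close>

text \<open>The constants of the perturbation bounds: \<open>p\<^sup>2 / q\<close> bounds the distance of
  \<open>Pm\<close> from an admissible matrix, \<open>\<kappa>\<close> belongs to the gains, \<open>\<delta>\<close> to the products of closed-loop
  matrices, \<open>\<mu>\<close> and \<open>\<eta>\<close> to the disturbance gains and their differences.\<close>

definition b :: real where "b = opnorm B"
definition \<kappa> :: real where "\<kappa> = 1 / r * (b * (p\<^sup>2 / q * C))"
definition \<delta> :: real where "\<delta> = C * (b * (\<kappa> * C)) / (1 - \<gamma>)"
definition \<mu> :: real where "\<mu> = 1 / r * b * C * p"
definition \<eta> :: real where
  "\<eta> = 1 / r * (b * (p\<^sup>2 / q) * b) * (1 / r) * b * C * p + 1 / r * b * \<delta> * p + 1 / r * b * C * (p\<^sup>2 / q)"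

lemma b_nonneg: "0 \<le> b"
  by (simp add: b_def opnorm_nonneg)

lemma \<kappa>_nonneg: "0 \<le> \<kappa>"
  and \<mu>_nonneg: "0 \<le> \<mu>"
  and \<eta>_nonneg: "0 \<le> \<eta>"
proof -
  show \<kappa>: "0 \<le> \<kappa>"
    using r_pos q_pos b_nonneg C_nonneg by (simp add: \<kappa>_def)
  then have \<delta>: "0 \<le> \<delta>"
    using \<gamma>_bounds b_nonneg C_nonneg by (simp add: \<delta>_def)
  show "0 \<le> \<mu>"
    using r_pos p_pos b_nonneg C_nonneg by (simp add: \<mu>_def)
  show "0 \<le> \<eta>"
    using r_pos q_pos p_pos b_nonneg C_nonneg \<delta> by (simp add: \<eta>_def)
qed

lemma opnorm_rc_diff_le:
  assumes S: "adm S" and e: "e \<le> T" and t: "1 \<le> t" "t \<le> e"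
  shows "opnorm (rc Pm e t - rc S e t) \<le> p\<^sup>2 / q * \<gamma> ^ (e - t)"
proof (rule opnorm_le_of_quad)
  have adm: "adm (rc Pm e s)" "adm (rc S e s)" if "1 \<le> s" for s
    using that S e by (auto intro: adm_rc adm_Pm)
  show "psd (rc Pm e t - rc S e t)"
    using adm[OF t(1)] rc_mono[OF S adm_Pm e t adm_le_Pm[OF S]]
    by (auto simp: psd_def adm_def quad_diff_matrix intro!: sym_mat_diff)
  show "0 \<le> p\<^sup>2 / q * \<gamma> ^ (e - t)"
    using q_pos \<gamma>_bounds by simp
  fix x
  have "quad Pm y \<le> (1 + p / q) * quad S y" for y
  proof -
    have "quad Pm y \<le> p / q * (q * (norm y)\<^sup>2)"
      using Pm_le[of y] q_pos by simp
    also have "\<dots> \<le> p / q * quad S y"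
      using q_pos p_pos adm_ge[OF S] by (intro mult_left_mono) auto
    finally show ?thesis
      using adm_psd[OF S] unfolding psd_def by (simp add: distrib_right add_increasing)
  qed
  then have "quad (rc Pm e (e - (e - t))) x \<le>
      (1 + (a / (q + a)) ^ (e - t) * (p / q)) * quad (rc S e (e - (e - t))) x"
  proof (intro riccati_iterates_contract[where N = "e - t" and Q = "\<lambda>k. Q (e - Suc k)"
        and R = "\<lambda>k. R (e - Suc k)" and X = "\<lambda>k. rc S e (e - k)" and Y = "\<lambda>k. rc Pm e (e - k)"
        and A = A and B = B])
    fix k assume k: "k < e - t"
    then have k': "e - k = Suc (e - Suc k)" "e - Suc k < e" "e - Suc k \<in> {1..<T}" "e - Suc k \<in> {1..T}"
      using e t by auto
    show "pos_def (R (e - Suc k))" by (rule pos_def_R[OF k'(3)])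
    show "rc S e (e - Suc k) = riccati_F A B (Q (e - Suc k)) (R (e - Suc k)) (rc S e (e - k))"
      "rc Pm e (e - Suc k) = riccati_F A B (Q (e - Suc k)) (R (e - Suc k)) (rc Pm e (e - k))"
      unfolding k'(1) by (rule riccati_rec_step[OF k'(2)])+
    show "q * (norm x)\<^sup>2 \<le> quad (Q (e - Suc k)) x" for x by (rule Q_ge[OF k'(4)])
    have "1 \<le> e - k" using k t by linarith
    then show "quad (rc S e (e - k)) (A *v x) \<le> a * (norm x)\<^sup>2" for x
      using adm_le_Pm[OF adm(2)] Pm_A_le by (meson order_trans)
  next
    fix k assume k: "k \<le> e - t"
    then show "psd (rc S e (e - k))" "psd (rc Pm e (e - k))"
      using t by (auto intro!: adm_psd adm)
  qed (use q_pos p_pos a_nonneg in auto)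
  then have "quad (rc Pm e t) x \<le> (1 + \<gamma> ^ (e - t) * (p / q)) * quad (rc S e t) x"
    using t by (simp add: \<gamma>_def)
  then have "quad (rc Pm e t - rc S e t) x \<le> \<gamma> ^ (e - t) * (p / q) * quad (rc S e t) x"
    by (simp add: quad_diff_matrix algebra_simps)
  also have "\<dots> \<le> \<gamma> ^ (e - t) * (p / q) * (p * (norm x)\<^sup>2)"
    using \<gamma>_bounds q_pos p_pos by (intro mult_left_mono adm_le adm t) auto
  finally show "quad (rc Pm e t - rc S e t) x \<le> p\<^sup>2 / q * \<gamma> ^ (e - t) * (norm x)\<^sup>2"
    by (simp add: power2_eq_square ac_simps)
qed

end

text \<open>The gain is the minimizer of a quadratic function, so the difference of two gains is
  governed by the residual of the first order condition, and the closed-loop matrix appears as a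
  factor. It carries the factor \<open>\<rho>\<close> that the bound on products of closed-loop matrices
  needs when one factor has been replaced.\<close>

lemma lq_gain_diff:
  assumes "pos_def R" "psd P" "psd P'"
  shows "lq_gain A B R P' - lq_gain A B R P =
    matrix_inv (lq_hess B R P) ** (transpose B ** (P' - P) ** (A - B ** lq_gain A B R P'))"
proof -
  let ?K = "lq_gain A B R P" and ?K' = "lq_gain A B R P'"
  have "lq_hess B R P *v (?K' *v x - ?K *v x) =
      transpose B *v ((P' - P) *v ((A - B ** ?K') *v x))" for x
  proof -
    have "lq_hess B R P' *v y = lq_hess B R P *v y + transpose B *v ((P' - P) *v (B *v y))" for y
      by (simp add: lq_hess_def matrix_vector_mul_assoc[symmetric] algebra_simps)
    then have "lq_hess B R P *v (?K' *v x) =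
        transpose B *v (P' *v (A *v x)) - transpose B *v ((P' - P) *v (B *v (?K' *v x)))"
      using lq_hess_gain[OF assms(1,3), of B A x] by (simp add: eq_diff_eq)
    then show ?thesis
      using lq_hess_gain[OF assms(1,2), of B A x]
      by (simp add: matrix_vector_mul_assoc[symmetric] algebra_simps)
  qed
  then have "matrix_inv (lq_hess B R P) *v (lq_hess B R P *v (?K' *v x - ?K *v x)) =
      matrix_inv (lq_hess B R P) *v (transpose B *v ((P' - P) *v ((A - B ** ?K') *v x)))" for x
    by simp
  then have "?K' *v x - ?K *v x =
      matrix_inv (lq_hess B R P) *v (transpose B *v ((P' - P) *v ((A - B ** ?K') *v x)))" for x
    using pos_def_inverse(1)[OF pos_def_lq_hess[OF assms(1,2)], of B]
    by (simp only: matrix_vector_mul_assoc[of "matrix_inv _" "lq_hess _ _ _"] matrix_vector_mul_lid)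
  then show ?thesis
    by (simp add: matrix_eq matrix_vector_mult_diff_rdistrib matrix_vector_mul_assoc[symmetric])
qed

lemma lq_hess_inverse_diff:
  assumes "pos_def R" "psd P" "psd P'"
  shows "matrix_inv (lq_hess B R P') - matrix_inv (lq_hess B R P) =
    - (matrix_inv (lq_hess B R P) ** (transpose B ** (P' - P) ** B) ** matrix_inv (lq_hess B R P'))"
proof -
  let ?G = "lq_hess B R P" and ?G' = "lq_hess B R P'"
  have inv: "matrix_inv ?G *v (?G *v y) = y" and inv': "?G' *v (matrix_inv ?G' *v y) = y" for y
    using pos_def_inverse(1)[OF pos_def_lq_hess[OF assms(1,2), of B]]
      pos_def_inverse(2)[OF pos_def_lq_hess[OF assms(1,3), of B]]
    by (simp_all add: matrix_vector_mul_assoc)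
  have diff: "(transpose B ** (P' - P) ** B) *v y = ?G' *v y - ?G *v y" for y
    by (simp add: lq_hess_def matrix_vector_mul_assoc[symmetric] algebra_simps)
  have "(matrix_inv ?G ** (transpose B ** (P' - P) ** B) ** matrix_inv ?G') *v x =
      matrix_inv ?G *v x - matrix_inv ?G' *v x" for x
  proof -
    have "(matrix_inv ?G ** (transpose B ** (P' - P) ** B) ** matrix_inv ?G') *v x =
        matrix_inv ?G *v (?G' *v (matrix_inv ?G' *v x) - ?G *v (matrix_inv ?G' *v x))"
      unfolding diff[symmetric] by (simp only: matrix_vector_mul_assoc matrix_mul_assoc)
    also have "\<dots> = matrix_inv ?G *v x - matrix_inv ?G' *v x"
      by (simp only: matrix_vector_mult_diff_distrib inv inv')
    finally show ?thesis .
  qed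
  then have "matrix_inv ?G ** (transpose B ** (P' - P) ** B) ** matrix_inv ?G' =
      matrix_inv ?G - matrix_inv ?G'"
    by (simp add: matrix_eq matrix_vector_mult_diff_rdistrib)
  then show ?thesis by simp
qed

context lq_horizon
begin

lemma opnorm_gain_diff_le:
  assumes S: "adm S" and e: "e \<le> T" and t: "1 \<le> t" "t < e"
  shows "opnorm (K Pm e t - K S e t) \<le> \<kappa> * \<rho> * \<gamma> ^ (e - Suc t)"
proof -
  have t': "t \<in> {1..<T}" using e t by auto
  have psd: "psd (rc S e (Suc t))" "psd (rc Pm e (Suc t))"
    using S e by (auto intro!: adm_psd adm_rc adm_Pm)
  have "K Pm e t - K S e t =
      Hi S e t ** (transpose B ** (rc Pm e (Suc t) - rc S e (Suc t)) ** (A - B ** K Pm e t))"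
    using lq_gain_diff[OF pos_def_R[OF t'] psd, of A B] by (simp add: gain_eq_lq_gain)
  moreover have "opnorm \<dots> \<le> 1 / r * ((b * (p\<^sup>2 / q * \<gamma> ^ (e - Suc t))) * (C * \<rho>))"
    using S e t t' unfolding b_def
    by (intro opnorm_mult_mono opnorm_Hi_le opnorm_transpose_le opnorm_rc_diff_le
        opnorm_closed_loop_le adm_Pm) auto
  ultimately show ?thesis
    by (simp add: \<kappa>_def ac_simps)
qed

lemma sum_geometric_tail_le:
  assumes "0 \<le> c" "c < 1" "t \<le> e"
  shows "(\<Sum>l = s..<t. c ^ (e - Suc l)) \<le> c ^ (e - t) / (1 - (c::real))"
  using assms(3)
proof (induction t)
  case 0
  then show ?case using assms(1,2) by simp
next
  case (Suc t)
  have "(\<Sum>l = s..<Suc t. c ^ (e - Suc l)) \<le> c ^ (e - t) / (1 - c) + c ^ (e - Suc t)"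
  proof (cases "s \<le> t")
    case True
    with Suc show ?thesis by simp
  qed (use assms(1,2) in auto)
  also have "c ^ (e - t) = c * c ^ (e - Suc t)"
    using Suc.prems by (metis Suc_diff_Suc Suc_le_lessD power_Suc)
  also have "c * c ^ (e - Suc t) / (1 - c) + c ^ (e - Suc t) = c ^ (e - Suc t) / (1 - c)"
    using assms(2) by (simp add: field_simps)
  finally show ?case .
qed

lemma opnorm_\<Phi>_diff_le:
  assumes S: "adm S" and e: "e \<le> T" and st: "1 \<le> s" "s \<le> t" "t \<le> e"
  shows "opnorm (\<Phi> Pm e t s - \<Phi> S e t s) \<le> \<delta> * \<rho> ^ (t - s) * \<gamma> ^ (e - t)"
proof (rule opnorm_le)
  fix x
  let ?c = "C * (b * (\<kappa> * C)) * \<rho> ^ (t - s)"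
  have summand: "norm (\<Phi> Pm e t (Suc l) *v (B *v ((K S e l - K Pm e l) *v (\<Phi> S e l s *v x))))
      \<le> ?c * \<gamma> ^ (e - Suc l) * norm x" if l: "l \<in> {s..<t}" for l
  proof -
    have "opnorm (K S e l - K Pm e l) = opnorm (K Pm e l - K S e l)"
      by (metis minus_diff_eq opnorm_minus)
    also have "\<dots> \<le> \<kappa> * \<rho> * \<gamma> ^ (e - Suc l)"
      using l S e st by (intro opnorm_gain_diff_le) auto
    finally have "opnorm (\<Phi> Pm e t (Suc l) ** (B ** ((K S e l - K Pm e l) ** \<Phi> S e l s)))
        \<le> (C * \<rho> ^ (t - Suc l)) * (b * ((\<kappa> * \<rho> * \<gamma> ^ (e - Suc l)) * (C * \<rho> ^ (l - s))))"
      using l S e st unfolding b_def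
      by (intro opnorm_mult_mono opnorm_\<Phi>_le adm_Pm) auto
    also have "\<dots> = C * (b * (\<kappa> * C)) * (\<rho> ^ (t - Suc l) * \<rho> * \<rho> ^ (l - s)) * \<gamma> ^ (e - Suc l)"
      by simp
    also have "\<rho> ^ (t - Suc l) * \<rho> * \<rho> ^ (l - s) = \<rho> ^ (t - s)"
    proof -
      have "t - s = Suc (t - Suc l) + (l - s)" using l by auto
      then show ?thesis by (simp only: power_add power_Suc) (simp only: ac_simps)
    qed
    finally have "opnorm (\<Phi> Pm e t (Suc l) ** (B ** ((K S e l - K Pm e l) ** \<Phi> S e l s))) * norm x
        \<le> ?c * \<gamma> ^ (e - Suc l) * norm x"
      by (intro mult_right_mono) auto
    then show ?thesis
      using norm_le_opnorm[of "\<Phi> Pm e t (Suc l) ** (B ** ((K S e l - K Pm e l) ** \<Phi> S e l s))" x]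
      by (simp add: matrix_vector_mul_assoc)
  qed
  have "norm ((\<Phi> Pm e t s - \<Phi> S e t s) *v x) \<le> (\<Sum>l = s..<t. ?c * \<gamma> ^ (e - Suc l) * norm x)"
    by (subst matrix_vector_mult_diff_rdistrib, subst transition_diff) (intro sum_norm_le summand)
  also have "\<dots> = ?c * norm x * (\<Sum>l = s..<t. \<gamma> ^ (e - Suc l))"
    by (simp add: sum_distrib_left ac_simps)
  also have "\<dots> \<le> ?c * norm x * (\<gamma> ^ (e - t) / (1 - \<gamma>))"
    using \<rho>_bounds \<gamma>_bounds \<kappa>_nonneg b_nonneg C_nonneg st
    by (intro mult_left_mono sum_geometric_tail_le) auto
  finally show "norm ((\<Phi> Pm e t s - \<Phi> S e t s) *v x) \<le> \<delta> * \<rho> ^ (t - s) * \<gamma> ^ (e - t) * norm x"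
    by (simp add: \<delta>_def ac_simps)
qed

abbreviation Kd :: "real^'n^'n \<Rightarrow> nat \<Rightarrow> nat \<Rightarrow> nat \<Rightarrow> real^'n^'u" where
  "Kd S e \<equiv> dist_gain A B R (rc S e)"

lemma dist_gain_eq:
  "Kd S e t i = Hi S e t ** transpose B ** transpose (\<Phi> S e (Suc i) (Suc t)) ** rc S e (Suc i)"
  by (simp add: dist_gain_def lq_hess_def)

lemma opnorm_transpose_\<Phi>_le:
  assumes "adm S" "e \<le> T" "1 \<le> t" "t \<le> i" "i < e"
  shows "opnorm (transpose (\<Phi> S e (Suc i) (Suc t))) \<le> C * \<rho> ^ (i - t)"
  using opnorm_\<Phi>_le[of S e "Suc t" "Suc i"] assms
  by (intro order_trans[OF opnorm_transpose_le]) (simp del: transition.simps)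

lemma opnorm_dist_gain_le:
  assumes S: "adm S" and e: "e \<le> T" and t: "1 \<le> t" "t \<le> i" "i < e"
  shows "opnorm (Kd S e t i) \<le> \<mu> * \<rho> ^ (i - t)"
proof -
  have "opnorm (Kd S e t i) \<le> 1 / r * b * (C * \<rho> ^ (i - t)) * p"
    unfolding dist_gain_eq b_def
    using S e t by (intro opnorm_mult_mono opnorm_transpose_\<Phi>_le opnorm_Hi_le opnorm_transpose_le opnorm_adm_le adm_rc) auto
  then show ?thesis by (simp add: \<mu>_def ac_simps)
qed

text \<open>The perturbation of a product of three factors; the middle one brings \<open>\<rho> ^ (i - t)\<close>
  in each term. The first factor is known up to \<open>\<gamma> ^ (e - t - 1)\<close>, and the others only up to
  \<open>\<gamma> ^ (e - i - 1)\<close>, which is the larger one.\<close>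

lemma opnorm_dist_gain_diff_le:
  assumes S: "adm S" and e: "e \<le> T" and t: "1 \<le> t" "t \<le> i" "i < e"
  shows "opnorm (Kd Pm e t i - Kd S e t i) \<le> \<eta> * \<rho> ^ (i - t) * \<gamma> ^ (e - Suc i)"
proof -
  have t': "t \<in> {1..<T}" using e t by auto
  let ?D = "rc Pm e (Suc t) - rc S e (Suc t)"
  let ?F = "\<Phi> S e (Suc i) (Suc t)" and ?F' = "\<Phi> Pm e (Suc i) (Suc t)"
  let ?m = "i - t" and ?g = "\<gamma> ^ (e - Suc i)"
  have psd: "psd (rc S e (Suc t))" "psd (rc Pm e (Suc t))"
    using S e by (auto intro!: adm_psd adm_rc adm_Pm)
  note inv = lq_hess_inverse_diff[OF pos_def_R[OF t'] psd, of B]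
  have H: "opnorm (Hi Pm e t - Hi S e t) \<le> 1 / r * (b * (p\<^sup>2 / q * ?g) * b) * (1 / r)"
  proof -
    have "opnorm ?D \<le> p\<^sup>2 / q * \<gamma> ^ (e - Suc t)"
      using S e t by (intro opnorm_rc_diff_le) auto
    also have "\<dots> \<le> p\<^sup>2 / q * ?g"
      using q_pos t \<gamma>_bounds by (intro mult_left_mono power_decreasing) auto
    finally show ?thesis
      unfolding inv opnorm_minus b_def using S e t'
      by (intro opnorm_mult_mono opnorm_Hi_le opnorm_transpose_le adm_Pm) auto
  qed
  have F: "opnorm (transpose ?F) \<le> C * \<rho> ^ ?m" "opnorm (transpose ?F') \<le> C * \<rho> ^ ?m"
    using S e t by (auto intro!: opnorm_transpose_\<Phi>_le adm_Pm simp del: transition.simps)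
  have "opnorm (transpose (?F' - ?F)) \<le> \<delta> * \<rho> ^ (Suc i - Suc t) * \<gamma> ^ (e - Suc i)"
    by (rule order_trans[OF opnorm_transpose_le opnorm_\<Phi>_diff_le]) (use S e t in auto)
  then have F_diff: "opnorm (transpose ?F' - transpose ?F) \<le> \<delta> * \<rho> ^ ?m * ?g"
    by (simp add: transpose_diff)
  have P_diff: "opnorm (rc Pm e (Suc i) - rc S e (Suc i)) \<le> p\<^sup>2 / q * ?g"
    using S e t by (intro opnorm_rc_diff_le) auto
  have P: "opnorm (rc Pm e (Suc i)) \<le> p"
    using e by (intro opnorm_adm_le adm_rc adm_Pm) auto
  have Hi: "opnorm (Hi S e t) \<le> 1 / r" and B: "opnorm (transpose B) \<le> b"
    using S e t' by (auto simp: b_def intro: opnorm_Hi_le opnorm_transpose_le)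
  have split: "Kd Pm e t i - Kd S e t i =
      (Hi Pm e t - Hi S e t) ** transpose B ** transpose ?F' ** rc Pm e (Suc i)
      + (Hi S e t ** transpose B ** (transpose ?F' - transpose ?F) ** rc Pm e (Suc i)
      + Hi S e t ** transpose B ** transpose ?F ** (rc Pm e (Suc i) - rc S e (Suc i)))"
    unfolding dist_gain_eq
    by (simp add: matrix_eq matrix_vector_mul_assoc[symmetric] algebra_simps)
  have "opnorm (Kd Pm e t i - Kd S e t i) \<le>
      1 / r * (b * (p\<^sup>2 / q * ?g) * b) * (1 / r) * b * (C * \<rho> ^ ?m) * p
      + (1 / r * b * (\<delta> * \<rho> ^ ?m * ?g) * p + 1 / r * b * (C * \<rho> ^ ?m) * (p\<^sup>2 / q * ?g))"
    unfolding split
    by (intro order_trans[OF opnorm_add_le] add_mono opnorm_mult_mono H B F F_diff P P_diff Hi)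
  also have "\<dots> = \<eta> * \<rho> ^ ?m * ?g"
    by (simp add: \<eta>_def algebra_simps)
  finally show ?thesis .
qed

end

section \<open>The performance difference identity\<close>

context lq_horizon
begin

abbreviation Popt :: "nat \<Rightarrow> real^'n^'n" where
  "Popt \<equiv> rc (Q T) T"

abbreviation Kopt :: "nat \<Rightarrow> real^'n^'u" where
  "Kopt \<equiv> K (Q T) T"

text \<open>The gradient, up to the factor two, of the optimal cost to go at time \<open>t + 1\<close> is
  \<open>Popt (t + 1)\<close> applied to the predicted undisturbed state plus this vector, in which every
  future disturbance \<open>w i\<close> is pulled back along the optimal closed loop.\<close>

definition costate :: "(nat \<Rightarrow> real^'n) \<Rightarrow> nat \<Rightarrow> real^'n" where
  "costate w t = (\<Sum>i = t..<T.
     transpose (transition A B Kopt (Suc i) (Suc t)) *v (Popt (Suc i) *v w i))"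

lemma costate_end: "T \<le> t \<Longrightarrow> costate w t = 0"
  by (simp add: costate_def)

lemma costate_rec:
  assumes "t < T"
  shows "costate w t =
    Popt (Suc t) *v w t + transpose (A - B ** Kopt (Suc t)) *v costate w (Suc t)"
proof -
  let ?f = "\<lambda>t i. transpose (transition A B Kopt (Suc i) (Suc t)) *v (Popt (Suc i) *v w i)"
  have "costate w t = ?f t t + (\<Sum>i = Suc t..<T. ?f t i)"
    unfolding costate_def using assms by (rule sum.atLeast_Suc_lessThan)
  also have "(\<Sum>i = Suc t..<T. ?f t i) =
      (\<Sum>i = Suc t..<T. transpose (A - B ** Kopt (Suc t)) *v ?f (Suc t) i)"
  proof (intro sum.cong refl)
    fix i assume "i \<in> {Suc t..<T}"
    then show "?f t i = transpose (A - B ** Kopt (Suc t)) *v ?f (Suc t) i"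
      by (subst transition_rightmost)
         (auto simp: matrix_transpose_mul matrix_vector_mul_assoc matrix_mul_assoc
           simp del: transition.simps)
  qed
  also have "\<dots> = transpose (A - B ** Kopt (Suc t)) *v costate w (Suc t)"
    unfolding costate_def by (rule linear_sum[symmetric]) (rule matrix_vector_mul_linear)
  finally show ?thesis by simp
qed

text \<open>The part of the optimal cost to go that depends on the state.\<close>

definition cost_to_go :: "(nat \<Rightarrow> real^'n) \<Rightarrow> nat \<Rightarrow> real^'n \<Rightarrow> real" where
  "cost_to_go w t x =
     quad (Popt t) x + 2 * ((transpose (A - B ** Kopt t) *v costate w t) \<bullet> x)"

definition fixed_cost :: "(nat \<Rightarrow> real^'n) \<Rightarrow> nat \<Rightarrow> real" where
  "fixed_cost w t = quad (Popt (Suc t)) (w t)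
     + 2 * ((transpose (A - B ** Kopt (Suc t)) *v costate w (Suc t)) \<bullet> w t)
     - quad (Hi (Q T) T t) (transpose B *v costate w t)"

definition deviation :: "(nat \<Rightarrow> real^'n) \<Rightarrow> nat \<Rightarrow> real^'n \<Rightarrow> real^'u \<Rightarrow> real^'u" where
  "deviation w t x u = u + Kopt t *v x + Hi (Q T) T t *v (transpose B *v costate w t)"

abbreviation hess :: "nat \<Rightarrow> real^'u^'u" where
  "hess t \<equiv> lq_hess B (R t) (Popt (Suc t))"

lemma adm_QT: "adm (Q T)"
  using T_pos by (intro adm_Q) simp

lemma psd_Popt: "1 \<le> t \<Longrightarrow> psd (Popt t)"
  by (intro adm_psd adm_rc adm_QT) auto

lemma bellman_step:
  assumes t: "1 \<le> t" "t < T"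
  shows "quad (Q t) x + quad (R t) u + cost_to_go w (Suc t) (A *v x + B *v u + w t) =
    cost_to_go w t x + fixed_cost w t + quad (hess t) (deviation w t x u)"
proof -
  let ?P = "Popt (Suc t)" and ?G = "hess t" and ?H = "Hi (Q T) T t" and ?K = "Kopt t"
  let ?p = "transpose (A - B ** Kopt (Suc t)) *v costate w (Suc t)"
  let ?c = "costate w t" and ?z = "A *v x + B *v u" and ?v = "u + ?K *v x"
  let ?g = "?H *v (transpose B *v ?c)"
  have t': "t \<in> {1..<T}" using t by simp
  have psd: "psd ?P" by (rule psd_Popt) simp
  then have sym: "sym_mat ?P" by (simp add: psd_def)
  have pdG: "pos_def ?G" by (intro pos_def_lq_hess pos_def_R t' psd)
  then have symG: "sym_mat ?G" by (simp add: pos_def_def)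
  have c: "?c = ?P *v w t + ?p" by (rule costate_rec[OF t(2)])
  have Gg: "?G *v ?g = transpose B *v ?c"
    by (simp add: matrix_vector_mul_assoc matrix_mul_assoc pos_def_inverse(2)[OF pdG])
  have "cost_to_go w (Suc t) (?z + w t) = quad ?P ?z + 2 * (?z \<bullet> ?c) + quad ?P (w t) + 2 * (?p \<bullet> w t)"
    unfolding cost_to_go_def quad_add[OF sym] c
    by (simp add: inner_add_left inner_add_right inner_commute)
  moreover have "quad (Q t) x + quad (R t) u + quad ?P ?z = quad (Popt t) x + quad ?G ?v"
    using riccati_complete_square[OF pos_def_R[OF t'] psd, of "Q t" x u A B] t
    by (simp add: riccati_rec_step gain_eq_lq_gain)
  moreover have "?z \<bullet> ?c = (transpose (A - B ** ?K) *v ?c) \<bullet> x + ?v \<bullet> (transpose B *v ?c)"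
  proof -
    have z: "?z = (A - B ** ?K) *v x + B *v ?v"
      by (simp add: matrix_vector_mul_assoc[symmetric] algebra_simps)
    have "?z \<bullet> ?c = ((A - B ** ?K) *v x) \<bullet> ?c + (B *v ?v) \<bullet> ?c"
      unfolding z by (rule inner_add_left)
    then show ?thesis
      by (simp only: inner_transpose_left inner_transpose_right inner_commute[of ?c])
  qed
  moreover have "quad ?G (?v + ?g) = quad ?G ?v + 2 * (?v \<bullet> (transpose B *v ?c)) + quad ?H (transpose B *v ?c)"
  proof -
    have "quad ?G ?g = quad ?H (transpose B *v ?c)"
      unfolding quad_def Gg by (rule inner_commute)
    then show ?thesis
      unfolding quad_add[OF symG] Gg by simp
  qed
  ultimately show ?thesis
    by (simp add: cost_to_go_def fixed_cost_def deviation_def)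
qed

text \<open>Summing the Bellman equation along an arbitrary trajectory: the cost is a quantity that does
  not depend on the controls, plus the squared deviations from the optimal feedback.\<close>

lemma cost_eq_deviations:
  assumes x: "\<And>t. 1 \<le> t \<Longrightarrow> t < T \<Longrightarrow> x (Suc t) = A *v x t + B *v u t + w t"
  shows "cost T Q R x u = cost_to_go w 1 (x 1) + (\<Sum>t = 1..<T. fixed_cost w t)
    + (\<Sum>t = 1..<T. quad (hess t) (deviation w t (x t) (u t)))"
proof -
  have "(\<Sum>t = 1..<n. quad (Q t) (x t) + quad (R t) (u t)) + cost_to_go w n (x n) =
      cost_to_go w 1 (x 1) + (\<Sum>t = 1..<n. fixed_cost w t)
        + (\<Sum>t = 1..<n. quad (hess t) (deviation w t (x t) (u t)))"
    if "1 \<le> n" "n \<le> T" for n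
    using that
  proof (induction rule: dec_induct)
    case (step n)
    then have n: "1 \<le> n" "n < T" by auto
    show ?case
      using step.IH n bellman_step[OF n, of "x n" "u n" w] by (simp add: x[OF n])
  qed simp
  from this[of T] show ?thesis
    using T_pos by (simp add: cost_def quad_def cost_to_go_def costate_end)
qed

lemma regret_le_deviations:
  assumes x: "\<And>t. 1 \<le> t \<Longrightarrow> t < T \<Longrightarrow> x (Suc t) = A *v x t + B *v u t + w t"
  shows "cost T Q R x u - opt_cost A B T Q R w (x 1)
    \<le> (\<Sum>t = 1..<T. quad (hess t) (deviation w t (x t) (u t)))"
proof -
  have "cost_to_go w 1 (x 1) + (\<Sum>t = 1..<T. fixed_cost w t) \<le> opt_cost A B T Q R w (x 1)"
    unfolding opt_cost_def
  proof (rule cINF_greatest)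
    fix v
    let ?y = "traj A B w (x 1) v"
    have "cost T Q R ?y v = cost_to_go w 1 (?y 1) + (\<Sum>t = 1..<T. fixed_cost w t)
        + (\<Sum>t = 1..<T. quad (hess t) (deviation w t (?y t) (v t)))"
      by (rule cost_eq_deviations) simp
    moreover have "0 \<le> (\<Sum>t = 1..<T. quad (hess t) (deviation w t (?y t) (v t)))"
    proof (rule sum_nonneg)
      fix t assume "t \<in> {1..<T}"
      then have "psd (hess t)"
        by (intro pos_def_imp_psd pos_def_lq_hess pos_def_R psd_Popt) auto
      then show "0 \<le> quad (hess t) (deviation w t (?y t) (v t))"
        by (simp add: psd_def)
    qed
    ultimately show "cost_to_go w 1 (x 1) + (\<Sum>t = 1..<T. fixed_cost w t) \<le> cost T Q R ?y v"
      by simp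
  qed simp
  then show ?thesis
    using cost_eq_deviations[where x = x and u = u and w = w, OF x] by simp
qed

end

section \<open>Weighted sums\<close>

lemma weighted_sum_square_le:
  fixes c f :: "'a \<Rightarrow> real"
  assumes "\<And>i. i \<in> I \<Longrightarrow> 0 \<le> c i" and "sum c I \<le> s"
  shows "(\<Sum>i\<in>I. c i * f i)\<^sup>2 \<le> s * (\<Sum>i\<in>I. c i * (f i)\<^sup>2)"
proof -
  have "(\<Sum>i\<in>I. c i * f i)\<^sup>2 = (\<Sum>i\<in>I. sqrt (c i) * (sqrt (c i) * f i))\<^sup>2"
    using assms(1) by (intro arg_cong[where f = "\<lambda>x. x\<^sup>2"] sum.cong) (auto simp flip: mult.assoc)
  also have "\<dots> \<le> (\<Sum>i\<in>I. (sqrt (c i))\<^sup>2) * (\<Sum>i\<in>I. (sqrt (c i) * f i)\<^sup>2)"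
    by (rule Cauchy_Schwarz_ineq_sum)
  also have "\<dots> = sum c I * (\<Sum>i\<in>I. c i * (f i)\<^sup>2)"
    using assms(1) by (simp add: power_mult_distrib)
  also have "\<dots> \<le> s * (\<Sum>i\<in>I. c i * (f i)\<^sup>2)"
    using assms by (intro mult_right_mono sum_nonneg) auto
  finally show ?thesis .
qed

lemma sum_shift_le:
  fixes c :: "nat \<Rightarrow> real"
  assumes "\<And>N. (\<Sum>k<N. c k) \<le> s"
  shows "(\<Sum>i = t..<n. c (i - t)) \<le> s"
proof (cases "t \<le> n")
  case True
  have "(\<Sum>i = t..<n. c (i - t)) = (\<Sum>k<n - t. c k)"
    by (rule sum.reindex_bij_witness[of _ "\<lambda>k. k + t" "\<lambda>i. i - t"]) auto
  with assms show ?thesis by simp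
qed (use assms[of 0] in simp)

text \<open>Young's inequality for the correlation with a summable kernel.\<close>

lemma sum_correlation_square_le:
  fixes c f :: "nat \<Rightarrow> real"
  assumes c: "\<And>k. 0 \<le> c k" and s: "\<And>N. (\<Sum>k<N. c k) \<le> s"
  shows "(\<Sum>t = 1..<T. (\<Sum>i = t..<T. c (i - t) * f i)\<^sup>2) \<le> s\<^sup>2 * (\<Sum>i = 1..<T. (f i)\<^sup>2)"
proof -
  have s0: "0 \<le> s" using s[of 0] by simp
  have "(\<Sum>t = 1..<T. (\<Sum>i = t..<T. c (i - t) * f i)\<^sup>2)
      \<le> (\<Sum>t = 1..<T. s * (\<Sum>i = t..<T. c (i - t) * (f i)\<^sup>2))"
    by (intro sum_mono weighted_sum_square_le c sum_shift_le s)
  also have "\<dots> = s * (\<Sum>t = 1..<T. \<Sum>i \<in> {i \<in> {1..<T}. t \<le> i}. c (i - t) * (f i)\<^sup>2)"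
    unfolding sum_distrib_left[symmetric]
    by (intro arg_cong[where f = "\<lambda>x. s * x"] sum.cong) auto
  also have "\<dots> = s * (\<Sum>i = 1..<T. \<Sum>t \<in> {t \<in> {1..<T}. t \<le> i}. c (i - t) * (f i)\<^sup>2)"
    by (subst sum.swap_restrict) auto
  also have "\<dots> \<le> s * (\<Sum>i = 1..<T. s * (f i)\<^sup>2)"
  proof (intro mult_left_mono s0 sum_mono)
    fix i assume "i \<in> {1..<T}"
    then have "(\<Sum>t \<in> {t \<in> {1..<T}. t \<le> i}. c (i - t)) = (\<Sum>k<i. c k)"
      by (intro sum.reindex_bij_witness[of _ "\<lambda>k. i - k" "\<lambda>t. i - t"]) auto
    then show "(\<Sum>t \<in> {t \<in> {1..<T}. t \<le> i}. c (i - t) * (f i)\<^sup>2) \<le> s * (f i)\<^sup>2"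
      unfolding sum_distrib_right[symmetric] by (simp add: mult_right_mono s)
  qed
  finally show ?thesis
    by (simp add: sum_distrib_left power2_eq_square ac_simps)
qed

lemma sum_power_le:
  fixes c :: real
  assumes "0 \<le> c" "c < 1"
  shows "(\<Sum>k<N. c ^ k) \<le> 1 / (1 - c)"
  using assms by (simp add: sum_gp_strict divide_right_mono)

lemma square_sum3_le:
  fixes x y z :: real
  shows "(x + y + z)\<^sup>2 \<le> 3 * (x\<^sup>2 + y\<^sup>2 + z\<^sup>2)"
  using zero_le_power2[of "x - y"] zero_le_power2[of "y - z"] zero_le_power2[of "x - z"]
  by (simp add: power2_eq_square algebra_simps)

lemma mixed_rate_eq_sum:
  "mixed_rate \<rho> \<gamma> W = (\<Sum>i<W. \<gamma> ^ (W - i) * \<rho> ^ i)"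
proof (cases "\<rho> = \<gamma>")
  case False
  have "(\<rho> ^ W - \<gamma> ^ W) / (\<rho> - \<gamma>) = (\<Sum>i<W. \<gamma> ^ (W - Suc i) * \<rho> ^ i)"
    using False by (simp add: power_diff_sumr2)
  then show ?thesis
    using False unfolding mixed_rate_def
    by (simp add: sum_distrib_left flip: mult.assoc power_Suc) (simp add: Suc_diff_Suc)
qed (simp add: mixed_rate_def)

text \<open>The influence of a disturbance \<open>k\<close> steps ahead on the deviation from the optimal control:
  it reaches the present through \<open>k\<close> closed-loop factors. Inside the window only the error of
  its gain counts, and the backward Riccati recursion has contracted for
  \<open>W - k\<close> steps when it reaches the time of the disturbance.\<close>

definition window_weight :: "real \<Rightarrow> real \<Rightarrow> nat \<Rightarrow> nat \<Rightarrow> real" where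
  "window_weight \<rho> \<gamma> W k = (if k \<le> W then \<rho> ^ k * \<gamma> ^ (W - k) else \<rho> ^ k)"

lemma sum_window_weight_le:
  assumes "0 \<le> \<rho>" "\<rho> < 1" "0 \<le> \<gamma>"
  shows "(\<Sum>k<N. window_weight \<rho> \<gamma> W k) \<le> \<rho> ^ W / (1 - \<rho>) + mixed_rate \<rho> \<gamma> W"
proof -
  let ?c = "window_weight \<rho> \<gamma> W"
  have "(\<Sum>k<N. ?c k) \<le> (\<Sum>k<W + Suc N. ?c k)"
    using assms by (intro sum_mono2) (auto simp: window_weight_def)
  also have "\<dots> = (\<Sum>k<W. ?c k) + (\<Sum>k<Suc N. ?c (W + k))"
    by (induction N) auto
  also have "(\<Sum>k<W. ?c k) = mixed_rate \<rho> \<gamma> W"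
    unfolding mixed_rate_eq_sum by (intro sum.cong) (auto simp: window_weight_def)
  also have "(\<Sum>k<Suc N. ?c (W + k)) = \<rho> ^ W * (\<Sum>k<Suc N. \<rho> ^ k)"
    unfolding sum_distrib_left by (intro sum.cong) (auto simp: window_weight_def power_add)
  also have "\<dots> \<le> \<rho> ^ W * (1 / (1 - \<rho>))"
    using assms by (intro mult_left_mono sum_power_le) auto
  finally show ?thesis by simp
qed

section \<open>The regret of model predictive control\<close>

lemma gain_cong: "P (t + 1) = P' (t + 1) \<Longrightarrow> gain A B R P t = gain A B R P' t"
  by (simp add: gain_def)

lemma transition_cong:
  "(\<And>j. s \<le> j \<Longrightarrow> j < t \<Longrightarrow> K j = K' j) \<Longrightarrow> transition A B K t s = transition A B K' t s"
  by (induction t) auto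

lemma dist_gain_cong:
  assumes "t \<le> i" and "\<And>j. t < j \<Longrightarrow> j \<le> Suc i \<Longrightarrow> P j = P' j"
  shows "dist_gain A B R P t i = dist_gain A B R P' t i"
proof -
  have "transition A B (gain A B R P) (i + 1) (t + 1) = transition A B (gain A B R P') (i + 1) (t + 1)"
    by (intro transition_cong gain_cong assms(2)) auto
  then show ?thesis
    using assms unfolding dist_gain_def by simp
qed

text \<open>Convexity of the form, for the combination of \<open>x / c\<close> and \<open>y / (1 - c)\<close> with the
  weights \<open>c\<close> and \<open>1 - c\<close>. It replaces the triangle inequality when squared
  norms are to be summed over time.\<close>

lemma quad_add_le:
  assumes "psd M" and "0 < c" "c < 1"
  shows "quad M (x + y) \<le> quad M x / c + quad M y / (1 - c)"
proof -
  have sym: "sym_mat M" using assms(1) by (simp add: psd_def)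
  let ?m = "x \<bullet> (M *v y)"
  have "0 \<le> quad M ((1 - c) *\<^sub>R x + (- c) *\<^sub>R y)"
    using assms(1) by (simp add: psd_def)
  also have "\<dots> = (1 - c)\<^sup>2 * quad M x - 2 * c * (1 - c) * ?m + c\<^sup>2 * quad M y"
    by (simp only: quad_add[OF sym] quad_scaleR) (simp add: matrix_vector_mult_scaleR linear_neg[OF matrix_vector_mul_linear])
  finally have "c * (1 - c) * (2 * ?m + quad M x + quad M y) \<le> (1 - c) * quad M x + c * quad M y"
    by (simp add: power2_eq_square algebra_simps)
  then have "2 * ?m + quad M x + quad M y \<le> ((1 - c) * quad M x + c * quad M y) / (c * (1 - c))"
    using assms(2,3) by (simp add: field_simps)
  also have "\<dots> = quad M x / c + quad M y / (1 - c)"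
    using assms(2,3) by (simp add: divide_simps)
  finally show ?thesis
    by (simp add: quad_add[OF sym])
qed

lemma norm_matrix_vector_le: "opnorm M \<le> c \<Longrightarrow> norm (M *v x) \<le> c * norm x"
  by (meson norm_le_opnorm mult_right_mono norm_ge_zero order_trans)

context lq_horizon
begin

text \<open>The recursion used at time \<open>t\<close> runs from the time \<open>stop W t\<close>, with the value
  \<open>terminal W t\<close>; this covers both phases of the algorithm.\<close>

definition stop :: "nat \<Rightarrow> nat \<Rightarrow> nat" where
  "stop W t = min (t + W + 1) T"

definition terminal :: "nat \<Rightarrow> nat \<Rightarrow> real^'n^'n" where
  "terminal W t = (if t + W + 1 \<le> T then Pm else Q T)"

abbreviation Pmpc :: "nat \<Rightarrow> nat \<Rightarrow> nat \<Rightarrow> real^'n^'n" where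
  "Pmpc W t \<equiv> rc (terminal W t) (stop W t)"

abbreviation Kmpc :: "nat \<Rightarrow> nat \<Rightarrow> real^'n^'u" where
  "Kmpc W t \<equiv> K (terminal W t) (stop W t) t"

abbreviation Kdmpc :: "nat \<Rightarrow> nat \<Rightarrow> nat \<Rightarrow> real^'n^'u" where
  "Kdmpc W t \<equiv> Kd (terminal W t) (stop W t) t"

abbreviation Kdopt :: "nat \<Rightarrow> nat \<Rightarrow> real^'n^'u" where
  "Kdopt t \<equiv> Kd (Q T) T t"

lemma mpc_P_eq: "mpc_P A B Pm T W Q R t = Pmpc W t"
  by (simp add: mpc_P_def terminal_def stop_def)

lemma adm_terminal: "adm (terminal W t)"
  by (simp add: terminal_def adm_Pm adm_QT)

lemma stop_le: "stop W t \<le> T"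
  by (simp add: stop_def)

lemma less_stop: "t < T \<Longrightarrow> t < stop W t"
  by (simp add: stop_def)

text \<open>Within the window, the optimal recursion is a recursion that ends at the same time as the
  one used by the controller, from another admissible matrix.\<close>

lemma Popt_restart:
  assumes "t \<le> stop W s"
  shows "Popt t = rc (Popt (stop W s)) (stop W s) t"
  using assms stop_le by (rule riccati_rec_restart)

lemma mpc_gain_diff_le:
  assumes t: "1 \<le> t" "t < T"
  shows "opnorm (Kmpc W t - Kopt t) \<le> \<kappa> * \<gamma> ^ W"
proof (cases "t + W + 1 \<le> T")
  case True
  then have e: "terminal W t = Pm" "stop W t = t + W + 1" by (simp_all add: terminal_def stop_def)
  have "Kopt t = K (Popt (stop W t)) (stop W t) t"
    using less_stop[OF t(2), of W] by (intro gain_cong Popt_restart) simp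
  moreover have "opnorm (K Pm (stop W t) t - K (Popt (stop W t)) (stop W t) t) \<le> \<kappa> * \<rho> * \<gamma> ^ (stop W t - Suc t)"
    using t less_stop[OF t(2), of W] by (intro opnorm_gain_diff_le adm_rc adm_QT stop_le) auto
  moreover have "\<kappa> * \<rho> * \<gamma> ^ W \<le> \<kappa> * \<gamma> ^ W"
    using \<rho>_bounds \<gamma>_bounds \<kappa>_nonneg by (intro mult_right_mono mult_left_le) auto
  ultimately show ?thesis
    using e by simp
next
  case False
  then have "Kmpc W t = Kopt t" by (simp add: terminal_def stop_def min_def)
  then show ?thesis
    using \<kappa>_nonneg \<gamma>_bounds by simp
qed

lemma mpc_dist_gain_diff_le:
  assumes t: "1 \<le> t" "t \<le> i" "i < stop W t"
  shows "opnorm (Kdmpc W t i - Kdopt t i) \<le> \<eta> * window_weight \<rho> \<gamma> W (i - t)"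
proof (cases "t + W + 1 \<le> T")
  case True
  then have e: "terminal W t = Pm" "stop W t = t + W + 1" by (simp_all add: terminal_def stop_def)
  have "Kdopt t i = Kd (Popt (stop W t)) (stop W t) t i"
    using t by (intro dist_gain_cong Popt_restart) auto
  moreover have "opnorm (Kd Pm (stop W t) t i - Kd (Popt (stop W t)) (stop W t) t i)
      \<le> \<eta> * \<rho> ^ (i - t) * \<gamma> ^ (stop W t - Suc i)"
    using t by (intro opnorm_dist_gain_diff_le adm_rc adm_QT stop_le) auto
  moreover have "stop W t - Suc i = W - (i - t)" "i - t \<le> W"
    using t e by auto
  ultimately show ?thesis
    using e by (simp add: window_weight_def mult.assoc)
next
  case False
  then have "Kdmpc W t i = Kdopt t i" by (simp add: terminal_def stop_def min_def)
  then show ?thesis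
    using \<eta>_nonneg \<gamma>_bounds \<rho>_bounds by (simp add: window_weight_def)
qed

lemma mpc_dist_gain_le:
  assumes "1 \<le> t" "t \<le> i" "i < stop W t"
  shows "opnorm (Kdmpc W t i) \<le> \<mu> * \<rho> ^ (i - t)"
  using assms by (intro opnorm_dist_gain_le adm_terminal stop_le)

text \<open>At the next time, the window reaches further, and the new matrix at the end of the old
  window is below the old one. So the matrices \<open>Pmpc W t t\<close> define a Lyapunov function
  of the closed loop, although each gain belongs to a different recursion.\<close>

lemma Pmpc_next_le:
  assumes t: "1 \<le> t" "t < T"
  shows "quad (Pmpc W (Suc t) (Suc t)) x \<le> quad (Pmpc W t (Suc t)) x"
proof -
  let ?S = "rc (terminal W (Suc t)) (stop W (Suc t)) (stop W t)"
  have le: "Suc t \<le> stop W t" "stop W t \<le> stop W (Suc t)"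
    using t by (auto simp: stop_def)
  have S: "adm ?S"
    using le t by (intro adm_rc adm_terminal stop_le) auto
  have "quad ?S y \<le> quad (terminal W t) y" for y
  proof (cases "t + W + 1 \<le> T")
    case True
    then show ?thesis using adm_le_Pm[OF S] by (simp add: terminal_def)
  next
    case False
    then show ?thesis by (simp add: terminal_def stop_def min_def)
  qed
  then have "quad (rc ?S (stop W t) (Suc t)) x \<le> quad (Pmpc W t (Suc t)) x"
    using le t by (intro rc_mono S adm_terminal stop_le) auto
  then show ?thesis
    by (simp only: riccati_rec_restart[OF le, of A B Q R "terminal W (Suc t)"])
qed

lemma mpc_closed_loop_step:
  assumes t: "1 \<le> t" "t < T"
  shows "quad (Pmpc W (Suc t) (Suc t)) ((A - B ** Kmpc W t) *v x) \<le> \<rho>\<^sup>2 * quad (Pmpc W t t) x"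
  using Pmpc_next_le[OF t] closed_loop_step[OF adm_terminal stop_le t(1) less_stop[OF t(2)]]
  by (rule order_trans)

lemma adm_Pmpc: "1 \<le> t \<Longrightarrow> adm (Pmpc W t t)"
  by (intro adm_rc adm_terminal stop_le)

text \<open>Any number strictly between \<open>\<rho>\<close> and one serves as the rate of the perturbed
  Lyapunov function; it has to be positive also for \<open>\<rho> = 0\<close>, since \<open>quad_add_le\<close>
  divides by it.\<close>

definition \<theta> :: real where "\<theta> = (1 + \<rho>) / 2"
definition \<xi> :: real where "\<xi> = (p + p / (1 - \<theta>)) / (q * (1 - \<theta>))"

lemma \<theta>_bounds: "0 < \<theta>" "\<theta> < 1" "\<rho>\<^sup>2 / \<theta> \<le> \<theta>"
proof -
  show "0 < \<theta>" "\<theta> < 1" using \<rho>_bounds by (simp_all add: \<theta>_def)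
  moreover have "\<rho>\<^sup>2 \<le> \<theta>\<^sup>2"
    using \<rho>_bounds by (intro power_mono) (simp_all add: \<theta>_def)
  ultimately show "\<rho>\<^sup>2 / \<theta> \<le> \<theta>"
    by (simp add: divide_le_eq power2_eq_square)
qed

lemma \<xi>_nonneg: "0 \<le> \<xi>"
  using \<theta>_bounds q_pos p_pos by (simp add: \<xi>_def)

lemma sum_state_le:
  assumes x: "\<And>t. 1 \<le> t \<Longrightarrow> t < T \<Longrightarrow> x (Suc t) = (A - B ** Kmpc W t) *v x t + f t"
  shows "(\<Sum>t = 1..<T. (norm (x t))\<^sup>2) \<le> \<xi> * ((norm (x 1))\<^sup>2 + (\<Sum>t = 1..<T. (norm (f t))\<^sup>2))"
proof -
  let ?N = "\<lambda>t. quad (Pmpc W t t) (x t)" and ?c = "p / (1 - \<theta>)"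
  have energy_step: "?N (Suc t) \<le> \<theta> * ?N t + ?c * (norm (f t))\<^sup>2" if t: "1 \<le> t" "t < T" for t
  proof -
    let ?M = "Pmpc W (Suc t) (Suc t)" and ?y = "(A - B ** Kmpc W t) *v x t"
    have adm: "adm ?M" "adm (Pmpc W t t)" using t by (auto intro: adm_Pmpc)
    have "?N (Suc t) \<le> quad ?M ?y / \<theta> + quad ?M (f t) / (1 - \<theta>)"
      unfolding x[OF t] using \<theta>_bounds by (intro quad_add_le adm_psd adm)
    also have "\<dots> \<le> \<rho>\<^sup>2 * ?N t / \<theta> + p * (norm (f t))\<^sup>2 / (1 - \<theta>)"
      using \<theta>_bounds by (intro add_mono divide_right_mono mpc_closed_loop_step t adm_le adm) auto
    also have "\<rho>\<^sup>2 * ?N t / \<theta> \<le> \<theta> * ?N t"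
      using mult_right_mono[OF \<theta>_bounds(3), of "?N t"] adm_psd[OF adm(2)] by (simp add: psd_def)
    finally show ?thesis by simp
  qed
  have sum: "(1 - \<theta>) * (\<Sum>t = 1..<n. ?N t) + ?N n \<le> ?N 1 + ?c * (\<Sum>t = 1..<n. (norm (f t))\<^sup>2)"
    if "1 \<le> n" "n \<le> T" for n
    using that
  proof (induction rule: dec_induct)
    case (step n)
    then show ?case
      using energy_step[of n] by (simp add: algebra_simps)
  qed simp
  have "q * (1 - \<theta>) * (\<Sum>t = 1..<T. (norm (x t))\<^sup>2) = (1 - \<theta>) * (\<Sum>t = 1..<T. q * (norm (x t))\<^sup>2)"
    by (simp add: sum_distrib_left ac_simps)
  also have "\<dots> \<le> (1 - \<theta>) * (\<Sum>t = 1..<T. ?N t)"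
    using \<theta>_bounds by (intro mult_left_mono sum_mono adm_ge adm_Pmpc) auto
  also have "\<dots> \<le> ?N 1 + ?c * (\<Sum>t = 1..<T. (norm (f t))\<^sup>2)"
    using sum[OF T_pos order_refl] adm_psd[OF adm_Pmpc[OF T_pos, of W]] unfolding psd_def
    by (smt (verit))
  also have "\<dots> \<le> p * (norm (x 1))\<^sup>2 + ?c * (\<Sum>t = 1..<T. (norm (f t))\<^sup>2)"
    by (intro add_right_mono adm_le adm_Pmpc) simp
  also have "\<dots> \<le> (p + ?c) * (norm (x 1))\<^sup>2 + (p + ?c) * (\<Sum>t = 1..<T. (norm (f t))\<^sup>2)"
    using \<theta>_bounds p_pos by (intro add_mono mult_right_mono sum_nonneg) auto
  finally have "(\<Sum>t = 1..<T. (norm (x t))\<^sup>2) * (q * (1 - \<theta>)) \<le>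
      (p + ?c) * ((norm (x 1))\<^sup>2 + (\<Sum>t = 1..<T. (norm (f t))\<^sup>2))"
    by (simp only: distrib_left mult.commute)
  then have "(\<Sum>t = 1..<T. (norm (x t))\<^sup>2) \<le>
      (p + ?c) * ((norm (x 1))\<^sup>2 + (\<Sum>t = 1..<T. (norm (f t))\<^sup>2)) / (q * (1 - \<theta>))"
    using \<theta>_bounds q_pos by (intro mult_imp_le_div_pos) auto
  then show ?thesis
    by (simp only: \<xi>_def times_divide_eq_left)
qed

lemma feedforward_eq:
  "Hi (Q T) T t *v (transpose B *v costate w t) = (\<Sum>i = t..<T. Kdopt t i *v w i)"
proof -
  have "Hi (Q T) T t *v (transpose B *v costate w t) = (Hi (Q T) T t ** transpose B) *v costate w t"
    by (rule matrix_vector_mul_assoc)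
  also have "\<dots> = (\<Sum>i = t..<T. (Hi (Q T) T t ** transpose B) *v
      (transpose (transition A B Kopt (Suc i) (Suc t)) *v (Popt (Suc i) *v w i)))"
    unfolding costate_def by (rule linear_sum) (rule matrix_vector_mul_linear)
  finally show ?thesis
    by (simp only: dist_gain_eq matrix_vector_mul_assoc matrix_mul_assoc)
qed

lemma window_weight_nonneg: "0 \<le> window_weight \<rho> \<gamma> W k"
  using \<rho>_bounds \<gamma>_bounds by (simp add: window_weight_def)

text \<open>The control of the algorithm deviates from the optimal feedback at the same state for four
  reasons: the gain, the disturbance gains, the prediction errors, and the disturbances beyond the
  window. The second and the last are combined into a single kernel.\<close>

lemma norm_deviation_le:
  fixes w :: "nat \<Rightarrow> real^'n" and wp :: "nat \<Rightarrow> nat \<Rightarrow> real^'n"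
  assumes t: "1 \<le> t" "t < T"
  shows "norm (deviation w t x (mpc_control A B Pm T W Q R wp t x)) \<le>
    \<kappa> * \<gamma> ^ W * norm x
    + (\<eta> + \<mu>) * (\<Sum>i = t..<T. window_weight \<rho> \<gamma> W (i - t) * norm (w i))
    + \<mu> * (\<Sum>i = t..<stop W t. \<rho> ^ (i - t) * norm (wp t i - w i))"
proof -
  let ?e = "stop W t" and ?c = "\<lambda>i. window_weight \<rho> \<gamma> W (i - t)"
  have e: "t \<le> ?e" "?e \<le> T" using less_stop[OF t(2), of W] stop_le by auto
  have window: "{t..min (t + W) (T - 1)} = {t..<?e}"
    using t by (auto simp: stop_def)
  have split: "(\<Sum>i = t..<T. g i) = (\<Sum>i = t..<?e. g i) + (\<Sum>i = ?e..<T. g i)" for g :: "nat \<Rightarrow> 'z::comm_monoid_add"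
    using e by (simp add: sum.atLeastLessThan_concat)
  let ?S1 = "\<Sum>i = t..<?e. (Kdmpc W t i - Kdopt t i) *v w i"
    and ?S2 = "\<Sum>i = t..<?e. Kdmpc W t i *v (wp t i - w i)"
    and ?S3 = "\<Sum>i = ?e..<T. Kdopt t i *v w i"
  have triangle: "norm (- y1 - y2 - y3 + y4) \<le> norm y1 + norm y2 + norm y3 + norm y4"
    for y1 y2 y3 y4 :: "real^'u"
    by norm
  have "deviation w t x (mpc_control A B Pm T W Q R wp t x) =
      - ((Kmpc W t - Kopt t) *v x) - ?S1 - ?S2 + ?S3"
    unfolding deviation_def mpc_control_def mpc_P_eq window feedforward_eq split
    by (simp add: matrix_vector_mult_diff_rdistrib matrix_vector_mult_diff_distrib sum_subtractf)
  then have "norm (deviation w t x (mpc_control A B Pm T W Q R wp t x)) \<le>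
      norm ((Kmpc W t - Kopt t) *v x) + norm ?S1 + norm ?S2 + norm ?S3"
    by (simp only: triangle)
  moreover have "norm ((Kmpc W t - Kopt t) *v x) \<le> \<kappa> * \<gamma> ^ W * norm x"
    by (intro norm_matrix_vector_le mpc_gain_diff_le t)
  moreover have "norm ?S1 \<le> (\<eta> + \<mu>) * (\<Sum>i = t..<?e. ?c i * norm (w i))"
    unfolding sum_distrib_left
  proof (rule sum_norm_le)
    fix i assume "i \<in> {t..<?e}"
    then have "norm ((Kdmpc W t i - Kdopt t i) *v w i) \<le> \<eta> * ?c i * norm (w i)"
      using t by (intro norm_matrix_vector_le mpc_dist_gain_diff_le) auto
    also have "\<dots> \<le> (\<eta> + \<mu>) * ?c i * norm (w i)"
      using \<mu>_nonneg window_weight_nonneg by (intro mult_right_mono) auto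
    finally show "norm ((Kdmpc W t i - Kdopt t i) *v w i) \<le> (\<eta> + \<mu>) * (?c i * norm (w i))"
      by (simp only: mult.assoc)
  qed
  moreover have "norm ?S2 \<le> \<mu> * (\<Sum>i = t..<?e. \<rho> ^ (i - t) * norm (wp t i - w i))"
    unfolding sum_distrib_left
  proof (rule sum_norm_le)
    fix i assume "i \<in> {t..<?e}"
    then have "norm (Kdmpc W t i *v (wp t i - w i)) \<le> \<mu> * \<rho> ^ (i - t) * norm (wp t i - w i)"
      using t by (intro norm_matrix_vector_le mpc_dist_gain_le) auto
    then show "norm (Kdmpc W t i *v (wp t i - w i)) \<le> \<mu> * (\<rho> ^ (i - t) * norm (wp t i - w i))"
      by (simp only: mult.assoc)
  qed
  moreover have "norm ?S3 \<le> (\<eta> + \<mu>) * (\<Sum>i = ?e..<T. ?c i * norm (w i))"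
    unfolding sum_distrib_left
  proof (rule sum_norm_le)
    fix i assume i: "i \<in> {?e..<T}"
    then have "norm (Kdopt t i *v w i) \<le> \<mu> * \<rho> ^ (i - t) * norm (w i)"
      using t e by (intro norm_matrix_vector_le opnorm_dist_gain_le adm_QT) auto
    also have "\<rho> ^ (i - t) = ?c i"
      using i by (auto simp: window_weight_def stop_def)
    also have "\<mu> * ?c i * norm (w i) \<le> (\<eta> + \<mu>) * ?c i * norm (w i)"
      using \<eta>_nonneg window_weight_nonneg by (intro mult_right_mono) auto
    finally show "norm (Kdopt t i *v w i) \<le> (\<eta> + \<mu>) * (?c i * norm (w i))"
      by (simp only: mult.assoc)
  qed
  ultimately show ?thesis
    unfolding split[of "\<lambda>i. ?c i * norm (w i)"] distrib_left by linarith
qed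

text \<open>\<open>h\<close> bounds the Hessians, \<open>\<phi>\<close> and \<open>\<psi>\<close> the energy that disturbances and
  prediction errors feed into the closed loop, and \<open>\<alpha>1\<close> and \<open>\<alpha>2\<close> are the
  constants of the regret bound. All of them are functions of \<open>B\<close> and the real numbers
  \<open>q\<close>, \<open>p\<close>, \<open>r\<close>, \<open>rm\<close> and \<open>a\<close>, hence independent of the horizon and of the window.\<close>

definition h :: real where "h = rm + p * b\<^sup>2"
definition \<phi> :: real where "\<phi> = 3 * (1 + (b * \<mu> / (1 - \<rho>))\<^sup>2)"
definition \<psi> :: real where "\<psi> = 3 * ((b * \<mu>)\<^sup>2 / (1 - \<rho>))"
definition \<alpha>1 :: real where "\<alpha>1 = 3 * h * (\<kappa>\<^sup>2 * \<xi> * (1 + \<phi>) + (\<eta> + \<mu>)\<^sup>2)"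
definition \<alpha>2 :: real where "\<alpha>2 = 3 * h * (\<kappa>\<^sup>2 * \<xi> * \<psi> + \<mu>\<^sup>2 / (1 - \<rho>))"

lemma h_nonneg: "0 \<le> h"
  using rm_nonneg p_pos by (simp add: h_def)

lemma \<phi>_nonneg: "0 \<le> \<phi>" and \<psi>_nonneg: "0 \<le> \<psi>"
  using \<rho>_bounds by (simp_all add: \<phi>_def \<psi>_def)

lemma \<alpha>1_nonneg: "0 \<le> \<alpha>1" and \<alpha>2_nonneg: "0 \<le> \<alpha>2"
  using h_nonneg \<xi>_nonneg \<phi>_nonneg \<psi>_nonneg \<rho>_bounds by (simp_all add: \<alpha>1_def \<alpha>2_def)

lemma quad_hess_le:
  assumes "t \<in> {1..<T}"
  shows "quad (hess t) u \<le> h * (norm u)\<^sup>2"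
proof -
  have "quad (Popt (Suc t)) (B *v u) \<le> p * (norm (B *v u))\<^sup>2"
    by (intro adm_le adm_rc adm_QT) auto
  also have "\<dots> \<le> p * (b * norm u)\<^sup>2"
    using p_pos norm_le_opnorm[of B u] unfolding b_def
    by (intro mult_left_mono power_mono) auto
  finally show ?thesis
    using R_le[OF assms, of u] by (simp add: quad_lq_hess h_def power_mult_distrib algebra_simps)
qed

text \<open>The gain error contributes \<open>\<gamma> ^ W\<close> times the energy of the states, which by
  \<open>sum_state_le\<close> is in turn bounded by the energies of the initial state, the disturbances and
  the prediction errors. For the first two the factor \<open>\<gamma> ^ W \<le> S\<close> is kept; for the
  prediction errors \<open>\<gamma> ^ W \<le> 1\<close> suffices.\<close>

theorem mpc_regret_le:
  fixes w :: "nat \<Rightarrow> real^'n" and wp :: "nat \<Rightarrow> nat \<Rightarrow> real^'n" and W :: nat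
  defines "D \<equiv> \<Sum>t = 1..<T. (norm (w t))\<^sup>2"
    and "E \<equiv> \<Sum>t = 1..<T. \<Sum>i = t..<stop W t. \<rho> ^ (i - t) * (norm (wp t i - w i))\<^sup>2"
    and "S \<equiv> 1 / (1 - \<rho>) * (\<gamma> ^ W + \<rho> ^ W) + mixed_rate \<rho> \<gamma> W"
  shows "mpc_regret A B Pm T W Q R w wp x1 \<le> \<alpha>1 * S\<^sup>2 * ((norm x1)\<^sup>2 + D) + \<alpha>2 * E"
proof -
  define x where "x = mpc_state A B Pm T W Q R w wp x1"
  define u where "u = mpc_input A B Pm T W Q R w wp x1"
  define err where "err t = (\<Sum>i = t..<stop W t. \<rho> ^ (i - t) * norm (wp t i - w i))" for t
  define ahead where "ahead c t = (\<Sum>i = t..<T. c (i - t) * norm (w i))" for c t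
  have x1: "x 1 = x1" by (simp add: x_def)
  have u: "u t = mpc_control A B Pm T W Q R wp t (x t)" for t
    by (simp add: u_def x_def mpc_input_def)
  have dyn: "x (Suc t) = A *v x t + B *v u t + w t" if "1 \<le> t" for t
    using that by (simp add: x_def u_def mpc_input_def)
  have rate: "0 \<le> 1 / (1 - \<rho>)" "1 \<le> 1 / (1 - \<rho>)"
    using \<rho>_bounds by simp_all
  have mixed: "0 \<le> mixed_rate \<rho> \<gamma> W"
    unfolding mixed_rate_eq_sum using \<rho>_bounds \<gamma>_bounds by (intro sum_nonneg) auto
  have \<gamma>W: "0 \<le> \<gamma> ^ W" "\<gamma> ^ W \<le> 1" "\<gamma> ^ W \<le> S"
  proof -
    show "0 \<le> \<gamma> ^ W" "\<gamma> ^ W \<le> 1"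
      using \<gamma>_bounds by (auto intro: power_le_one)
    have "1 * (\<gamma> ^ W + 0) \<le> 1 / (1 - \<rho>) * (\<gamma> ^ W + \<rho> ^ W)"
      using \<rho>_bounds \<gamma>_bounds rate by (intro mult_mono) auto
    then show "\<gamma> ^ W \<le> S" using mixed by (simp add: S_def)
  qed
  have weight_S: "(\<Sum>k<N. window_weight \<rho> \<gamma> W k) \<le> S" for N
  proof -
    have "\<rho> ^ W / (1 - \<rho>) \<le> 1 / (1 - \<rho>) * (\<gamma> ^ W + \<rho> ^ W)"
      using \<rho>_bounds \<gamma>_bounds by (simp add: divide_right_mono)
    then show ?thesis
      using sum_window_weight_le[OF \<rho>_bounds \<gamma>_bounds(1), where N = N and W = W]
      unfolding S_def by linarith
  qed
  have D: "0 \<le> D" unfolding D_def by (intro sum_nonneg) auto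
  have E: "0 \<le> E" unfolding E_def using \<rho>_bounds by (intro sum_nonneg) auto
  have window_sum: "(\<Sum>t = 1..<T. (ahead (window_weight \<rho> \<gamma> W) t)\<^sup>2) \<le> S\<^sup>2 * D"
    unfolding ahead_def D_def
    by (intro sum_correlation_square_le window_weight_nonneg weight_S)
  have \<rho>_sum: "(\<Sum>t = 1..<T. (ahead (\<lambda>k. \<rho> ^ k) t)\<^sup>2) \<le> (1 / (1 - \<rho>))\<^sup>2 * D"
    unfolding ahead_def D_def
    by (intro sum_correlation_square_le sum_power_le zero_le_power \<rho>_bounds)
  have err_sum: "(\<Sum>t = 1..<T. (err t)\<^sup>2) \<le> 1 / (1 - \<rho>) * E"
    unfolding err_def E_def sum_distrib_left[of "1 / (1 - \<rho>)"]
    by (intro sum_mono weighted_sum_square_le[where s = "1 / (1 - \<rho>)", unfolded sum_distrib_left]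
        sum_shift_le sum_power_le zero_le_power \<rho>_bounds)

  define f where "f t = w t - B *v (\<Sum>i = t..<stop W t. Kdmpc W t i *v wp t i)" for t
  have closed: "x (Suc t) = (A - B ** Kmpc W t) *v x t + f t" if t: "1 \<le> t" "t < T" for t
  proof -
    have "{t..min (t + W) (T - 1)} = {t..<stop W t}"
      using t by (auto simp: stop_def)
    then show ?thesis
      unfolding dyn[OF t(1)] u mpc_control_def mpc_P_eq f_def
      by (simp add: matrix_vector_mul_assoc[symmetric] linear_neg[OF matrix_vector_mul_linear]
          algebra_simps)
  qed
  have norm_f: "norm (f t) \<le> norm (w t) + b * \<mu> * ahead (\<lambda>k. \<rho> ^ k) t + b * \<mu> * err t"
    if t: "1 \<le> t" "t < T" for t
  proof -
    have "norm (\<Sum>i = t..<stop W t. Kdmpc W t i *v wp t i) \<le>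
        (\<Sum>i = t..<stop W t. \<mu> * (\<rho> ^ (i - t) * norm (w i) + \<rho> ^ (i - t) * norm (wp t i - w i)))"
    proof (rule sum_norm_le)
      fix i assume "i \<in> {t..<stop W t}"
      then have "norm (Kdmpc W t i *v wp t i) \<le> \<mu> * \<rho> ^ (i - t) * norm (wp t i)"
        using t by (intro norm_matrix_vector_le mpc_dist_gain_le) auto
      also have "\<dots> \<le> \<mu> * \<rho> ^ (i - t) * (norm (w i) + norm (wp t i - w i))"
        using \<mu>_nonneg \<rho>_bounds by (intro mult_left_mono) (norm, simp)
      finally show "norm (Kdmpc W t i *v wp t i) \<le>
          \<mu> * (\<rho> ^ (i - t) * norm (w i) + \<rho> ^ (i - t) * norm (wp t i - w i))"
        by (simp add: algebra_simps)
    qed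
    also have "\<dots> = \<mu> * ((\<Sum>i = t..<stop W t. \<rho> ^ (i - t) * norm (w i)) + err t)"
      by (simp add: err_def sum.distrib sum_distrib_left[symmetric])
    also have "\<dots> \<le> \<mu> * (ahead (\<lambda>k. \<rho> ^ k) t + err t)"
      unfolding ahead_def using \<mu>_nonneg \<rho>_bounds stop_le
      by (intro mult_left_mono add_right_mono sum_mono2) auto
    finally have "b * norm (\<Sum>i = t..<stop W t. Kdmpc W t i *v wp t i) \<le>
        b * (\<mu> * (ahead (\<lambda>k. \<rho> ^ k) t + err t))"
      by (intro mult_left_mono b_nonneg)
    moreover have "norm (f t) \<le> norm (w t) + b * norm (\<Sum>i = t..<stop W t. Kdmpc W t i *v wp t i)"
      unfolding f_def b_def by (rule order_trans[OF norm_triangle_ineq4]) (simp add: norm_le_opnorm)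
    ultimately show ?thesis by (simp add: algebra_simps)
  qed
  have f_sum: "(\<Sum>t = 1..<T. (norm (f t))\<^sup>2) \<le> \<phi> * D + \<psi> * E"
  proof -
    have "(\<Sum>t = 1..<T. (norm (f t))\<^sup>2) \<le> (\<Sum>t = 1..<T. 3 * ((norm (w t))\<^sup>2
        + (b * \<mu> * ahead (\<lambda>k. \<rho> ^ k) t)\<^sup>2 + (b * \<mu> * err t)\<^sup>2))"
      by (intro sum_mono order_trans[OF power_mono[OF norm_f] square_sum3_le]) auto
    also have "\<dots> = 3 * (D + (b * \<mu>)\<^sup>2 * (\<Sum>t = 1..<T. (ahead (\<lambda>k. \<rho> ^ k) t)\<^sup>2)
        + (b * \<mu>)\<^sup>2 * (\<Sum>t = 1..<T. (err t)\<^sup>2))"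
      by (simp add: D_def sum.distrib sum_distrib_left power_mult_distrib distrib_left)
    also have "\<dots> \<le> 3 * (D + (b * \<mu>)\<^sup>2 * ((1 / (1 - \<rho>))\<^sup>2 * D) + (b * \<mu>)\<^sup>2 * (1 / (1 - \<rho>) * E))"
      using \<rho>_sum err_sum by (intro mult_left_mono add_mono) auto
    also have "\<dots> = \<phi> * D + \<psi> * E"
      by (simp add: \<phi>_def \<psi>_def power_divide power_mult_distrib algebra_simps)
    finally show ?thesis .
  qed
  have x_sum: "(\<Sum>t = 1..<T. (norm (x t))\<^sup>2) \<le> \<xi> * ((norm x1)\<^sup>2 + (\<phi> * D + \<psi> * E))"
  proof -
    have "(\<Sum>t = 1..<T. (norm (x t))\<^sup>2) \<le> \<xi> * ((norm (x 1))\<^sup>2 + (\<Sum>t = 1..<T. (norm (f t))\<^sup>2))"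
      by (intro sum_state_le[where W = W] closed)
    also have "\<dots> \<le> \<xi> * ((norm x1)\<^sup>2 + (\<phi> * D + \<psi> * E))"
      unfolding x1 by (intro mult_left_mono add_left_mono f_sum \<xi>_nonneg)
    finally show ?thesis .
  qed

  have "mpc_regret A B Pm T W Q R w wp x1 = cost T Q R x u - opt_cost A B T Q R w (x 1)"
    by (simp add: mpc_regret_def x_def u_def)
  also have "\<dots> \<le> (\<Sum>t = 1..<T. quad (hess t) (deviation w t (x t) (u t)))"
    by (intro regret_le_deviations dyn)
  also have "\<dots> \<le> (\<Sum>t = 1..<T. h * (norm (deviation w t (x t) (u t)))\<^sup>2)"
    by (intro sum_mono quad_hess_le)
  also have "\<dots> \<le> (\<Sum>t = 1..<T. h * (3 * ((\<kappa> * \<gamma> ^ W * norm (x t))\<^sup>2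
      + ((\<eta> + \<mu>) * ahead (window_weight \<rho> \<gamma> W) t)\<^sup>2 + (\<mu> * err t)\<^sup>2)))"
  proof (intro sum_mono mult_left_mono h_nonneg order_trans[OF power_mono square_sum3_le])
    fix t assume "t \<in> {1..<T}"
    then show "norm (deviation w t (x t) (u t)) \<le> \<kappa> * \<gamma> ^ W * norm (x t)
        + (\<eta> + \<mu>) * ahead (window_weight \<rho> \<gamma> W) t + \<mu> * err t"
      unfolding u ahead_def err_def by (intro norm_deviation_le) auto
  qed auto
  also have "\<dots> = 3 * h * (\<kappa>\<^sup>2 * ((\<gamma> ^ W)\<^sup>2 * (\<Sum>t = 1..<T. (norm (x t))\<^sup>2))
      + (\<eta> + \<mu>)\<^sup>2 * (\<Sum>t = 1..<T. (ahead (window_weight \<rho> \<gamma> W) t)\<^sup>2) + \<mu>\<^sup>2 * (\<Sum>t = 1..<T. (err t)\<^sup>2))"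
    by (simp only: power_mult_distrib sum_distrib_left[symmetric] sum.distrib) (simp add: algebra_simps)
  also have "\<dots> \<le> 3 * h * (\<kappa>\<^sup>2 * (\<xi> * (S\<^sup>2 * ((1 + \<phi>) * ((norm x1)\<^sup>2 + D)) + \<psi> * E))
      + (\<eta> + \<mu>)\<^sup>2 * (S\<^sup>2 * ((norm x1)\<^sup>2 + D)) + \<mu>\<^sup>2 * (1 / (1 - \<rho>) * E))"
  proof (intro mult_left_mono add_mono err_sum zero_le_power2)
    have "(\<gamma> ^ W)\<^sup>2 * (\<Sum>t = 1..<T. (norm (x t))\<^sup>2)
        \<le> (\<gamma> ^ W)\<^sup>2 * (\<xi> * ((norm x1)\<^sup>2 + (\<phi> * D + \<psi> * E)))"
      by (intro mult_left_mono x_sum) simp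
    also have "\<dots> = \<xi> * ((\<gamma> ^ W)\<^sup>2 * ((norm x1)\<^sup>2 + \<phi> * D) + (\<gamma> ^ W)\<^sup>2 * (\<psi> * E))"
      by (simp add: algebra_simps)
    also have "\<dots> \<le> \<xi> * (S\<^sup>2 * ((1 + \<phi>) * ((norm x1)\<^sup>2 + D)) + 1 * (\<psi> * E))"
    proof (intro mult_left_mono[OF _ \<xi>_nonneg] add_mono mult_mono)
      show "(\<gamma> ^ W)\<^sup>2 \<le> S\<^sup>2" "(\<gamma> ^ W)\<^sup>2 \<le> 1"
        using \<gamma>W by (auto intro: power_mono power_le_one)
      show "(norm x1)\<^sup>2 + \<phi> * D \<le> (1 + \<phi>) * ((norm x1)\<^sup>2 + D)"
        using D \<phi>_nonneg by (simp add: algebra_simps)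
    qed (use D E \<phi>_nonneg \<psi>_nonneg in auto)
    finally show "(\<gamma> ^ W)\<^sup>2 * (\<Sum>t = 1..<T. (norm (x t))\<^sup>2)
        \<le> \<xi> * (S\<^sup>2 * ((1 + \<phi>) * ((norm x1)\<^sup>2 + D)) + \<psi> * E)" by simp
    show "(\<Sum>t = 1..<T. (ahead (window_weight \<rho> \<gamma> W) t)\<^sup>2) \<le> S\<^sup>2 * ((norm x1)\<^sup>2 + D)"
      by (rule order_trans[OF window_sum]) (intro mult_left_mono, auto)
  qed (use h_nonneg in auto)
  also have "\<dots> = \<alpha>1 * S\<^sup>2 * ((norm x1)\<^sup>2 + D) + \<alpha>2 * E"
    by (simp add: \<alpha>1_def \<alpha>2_def algebra_simps)
  finally show ?thesis .
qed

end

lemma dist_mult_diff: "dist_mult nd Bd (\<lambda>k. u k - v k) = dist_mult nd Bd u - dist_mult nd Bd v"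
  by (simp add: dist_mult_def scaleR_left_diff_distrib sum_subtractf)

text \<open>The solution of the algebraic Riccati equation for the largest costs is a supersolution for
  all admissible costs.\<close>

lemma lq_horizon_of_standing_assms:
  fixes A :: "real^'n^'n" and Bu :: "real^'u^'n"
  assumes pd: "pos_def Qmin" "pos_def Qmax" "pos_def Rmin" "pos_def Rmax"
    and stab: "stabilizable A Bu"
    and T: "1 \<le> T" and sa: "standing_assms A Qmin Qmax Rmin Rmax T Q R"
  defines "Pm \<equiv> dare_sol A Bu Qmax Rmax"
  shows "lq_horizon A Bu Q R T Pm (lambda_min Qmin) (lambda_max Pm) (lambda_min Rmin)
    (opnorm Rmax) (lambda_max (transpose A ** Pm ** A))"
proof -
  have Pm: "pos_def Pm" "riccati_F A Bu Qmax Rmax Pm = Pm"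
    unfolding Pm_def using dare_sol_properties[OF pd(2,4) stab] by auto
  have psdPm: "psd Pm" using Pm(1) by (rule pos_def_imp_psd)
  have sym: "sym_mat Pm" "sym_mat Qmin" "sym_mat Rmin" "sym_mat (transpose A ** Pm ** A)"
    using Pm(1) pd by (auto simp: pos_def_def intro: sym_mat_transpose_mult)
  have psdA: "psd (transpose A ** Pm ** A)"
    using sym(4) psdPm by (simp add: psd_def quad_transpose_mult)
  have Q: "sym_mat (Q t)" "quad Qmin x \<le> quad (Q t) x" "quad (Q t) x \<le> quad Qmax x"
    if "t \<in> {1..T}" for t x
    using sa that by (auto simp: standing_assms_def intro: loewner_le_quad)
  have R: "sym_mat (R t)" "quad Rmin u \<le> quad (R t) u" "quad (R t) u \<le> quad Rmax u"
    if "t \<in> {1..<T}" for t u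
    using sa that by (auto simp: standing_assms_def intro: loewner_le_quad)
  have posR: "pos_def (R t)" if "t \<in> {1..<T}" for t
    using R[OF that] pd(3) unfolding pos_def_iff_quad by (meson less_le_trans)
  show ?thesis
  proof
    show "0 < lambda_min Qmin" "0 < lambda_min Rmin"
      by (intro lambda_min_pos pd)+
    show "0 \<le> lambda_max (transpose A ** Pm ** A)"
      by (rule lambda_max_nonneg[OF psdA])
    show "1 \<le> T" by (rule T)
    show "psd (Q t)" if "t \<in> {1..T}" for t
      using Q[OF that] pos_def_imp_psd[OF pd(1)] unfolding psd_def by (meson order_trans)
    show "lambda_min Qmin * (norm x)\<^sup>2 \<le> quad (Q t) x" if "t \<in> {1..T}" for t x
      using lambda_min_le_quad[OF sym(2)] Q(2)[OF that] by (rule order_trans)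
    show "quad (Q t) x \<le> quad Pm x" if "t \<in> {1..T}" for t x
      using Q(3)[OF that, of x] riccati_F_ge[OF pd(4) psdPm, of Qmax x A Bu] Pm(2) by simp
    show "pos_def (R t)" if "t \<in> {1..<T}" for t
      by (rule posR[OF that])
    show "lambda_min Rmin * (norm u)\<^sup>2 \<le> quad (R t) u" if "t \<in> {1..<T}" for t u
      using lambda_min_le_quad[OF sym(3)] R(2)[OF that] by (rule order_trans)
    show "quad (R t) u \<le> opnorm Rmax * (norm u)\<^sup>2" if "t \<in> {1..<T}" for t u
      using R(3)[OF that, of u] quad_le_opnorm[of Rmax u] by simp
    show "0 \<le> opnorm Rmax" by (rule opnorm_nonneg)
    show "psd Pm" by (rule psdPm)
    show "quad (riccati_F A Bu (Q t) (R t) Pm) x \<le> quad Pm x" if t: "t \<in> {1..<T}" for t x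
    proof -
      have "t \<in> {1..T}" using t by simp
      then have "quad (riccati_F A Bu (Q t) (R t) Pm) x \<le> quad (riccati_F A Bu Qmax Rmax Pm) x"
        using t by (intro riccati_F_mono posR pd psdPm Q R order_refl)
      then show ?thesis using Pm(2) by simp
    qed
    show "quad Pm x \<le> lambda_max Pm * (norm x)\<^sup>2" for x
      by (rule quad_le_lambda_max[OF sym(1)])
    show "quad Pm (A *v x) \<le> lambda_max (transpose A ** Pm ** A) * (norm x)\<^sup>2" for x
      using quad_le_lambda_max[OF sym(4), of x] by (simp add: quad_transpose_mult)
  qed
qed

theorem theorem1:
  fixes A :: "real^'n^'n" and Bu :: "real^'u^'n"
    and Qmin Qmax :: "real^'n^'n" and Rmin Rmax :: "real^'u^'u"
  assumes "pos_def Qmin" and "pos_def Qmax" and "pos_def Rmin" and "pos_def Rmax"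
    and "stabilizable A Bu"
  shows "let Pmax = dare_sol A Bu Qmax Rmax;
             \<rho> = rho_rate Qmin Pmax;
             \<gamma> = gamma_rate A Qmin Pmax
    in \<exists>\<alpha>1 \<alpha>2 :: real.
      \<forall>(T::nat) (W::nat) (nd::nat) (Bd :: nat \<Rightarrow> real^'n) (x1 :: real^'n)
        (Q :: nat \<Rightarrow> real^'n^'n) (R :: nat \<Rightarrow> real^'u^'u)
        (d :: nat \<Rightarrow> nat \<Rightarrow> real) (dpred :: nat \<Rightarrow> nat \<Rightarrow> nat \<Rightarrow> real).
        T \<ge> 1 \<longrightarrow> standing_assms A Qmin Qmax Rmin Rmax T Q R \<longrightarrow>
        mpc_regret A Bu Pmax T W Q R
            (\<lambda>t. dist_mult nd Bd (d t)) (\<lambda>t i. dist_mult nd Bd (dpred t i)) x1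
        \<le> \<alpha>1 * (1 / (1 - \<rho>) * (\<gamma> ^ W + \<rho> ^ W) + mixed_rate \<rho> \<gamma> W)\<^sup>2
            * ((norm x1)\<^sup>2 + (\<Sum>t = 1..T. (norm (dist_mult nd Bd (d t)))\<^sup>2))
          + \<alpha>2 * (1 / (1 - \<rho>) + \<gamma> ^ W / (1 - \<rho>\<^sup>2)) * (1 + \<gamma> ^ W / (1 - \<rho>))
            * (\<Sum>j = 1..T - 1. \<Sum>i = j..min (j + W) (T - 1).
                 \<rho> ^ (i - j) * (norm (dist_mult nd Bd (\<lambda>k. dpred j i k - d i k)))\<^sup>2)"
proof -
  define Pm where "Pm = dare_sol A Bu Qmax Rmax"
  define q where "q = lambda_min Qmin"
  define p where "p = lambda_max Pm"
  define r where "r = lambda_min Rmin"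
  define rm where "rm = opnorm Rmax"
  define a where "a = lambda_max (transpose A ** Pm ** A)"
  define rho where "rho = rho_rate Qmin Pm"
  define gam where "gam = gamma_rate A Qmin Pm"
  define c1 where "c1 = lq_horizon.\<alpha>1 Bu q p r rm a"
  define c2 where "c2 = lq_horizon.\<alpha>2 Bu q p r rm"
  have "mpc_regret A Bu Pm T W Q R (\<lambda>t. dist_mult nd Bd (d t)) (\<lambda>t i. dist_mult nd Bd (dpred t i)) x1
      \<le> c1 * (1 / (1 - rho) * (gam ^ W + rho ^ W) + mixed_rate rho gam W)\<^sup>2
          * ((norm x1)\<^sup>2 + (\<Sum>t = 1..T. (norm (dist_mult nd Bd (d t)))\<^sup>2))
        + c2 * (1 / (1 - rho) + gam ^ W / (1 - rho\<^sup>2)) * (1 + gam ^ W / (1 - rho))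
          * (\<Sum>j = 1..T - 1. \<Sum>i = j..min (j + W) (T - 1).
               rho ^ (i - j) * (norm (dist_mult nd Bd (\<lambda>k. dpred j i k - d i k)))\<^sup>2)"
    if T: "1 \<le> T" and sa: "standing_assms A Qmin Qmax Rmin Rmax T Q R"
    for T W nd :: nat and Bd x1 Q R and d :: "nat \<Rightarrow> nat \<Rightarrow> real" and dpred
  proof -
    interpret lq_horizon A Bu Q R T Pm q p r rm a
      unfolding Pm_def q_def p_def r_def rm_def a_def
      by (rule lq_horizon_of_standing_assms[OF assms T sa])
    have rho: "\<rho> = rho" and gam: "\<gamma> = gam"
      unfolding \<rho>_def \<gamma>_def
      by (simp_all add: rho_def gam_def rho_rate_def gamma_rate_def q_def p_def a_def)
    let ?w = "\<lambda>t. dist_mult nd Bd (d t)" and ?wp = "\<lambda>t i. dist_mult nd Bd (dpred t i)"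
    let ?S = "1 / (1 - rho) * (gam ^ W + rho ^ W) + mixed_rate rho gam W"
    let ?D = "\<Sum>t = 1..T. (norm (?w t))\<^sup>2"
    let ?E = "\<Sum>j = 1..T - 1. \<Sum>i = j..min (j + W) (T - 1).
        rho ^ (i - j) * (norm (dist_mult nd Bd (\<lambda>k. dpred j i k - d i k)))\<^sup>2"
    have bounds: "0 \<le> rho" "rho < 1" "0 \<le> gam"
      using \<rho>_bounds \<gamma>_bounds by (simp_all add: rho gam)
    have E: "(\<Sum>t = 1..<T. \<Sum>i = t..<stop W t. rho ^ (i - t) * (norm (?wp t i - ?w i))\<^sup>2) = ?E"
      using T unfolding dist_mult_diff by (intro sum.cong) (auto simp: stop_def)
    have E_nonneg: "0 \<le> ?E"
      using bounds by (intro sum_nonneg) auto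
    have "mpc_regret A Bu Pm T W Q R ?w ?wp x1 \<le>
        c1 * ?S\<^sup>2 * ((norm x1)\<^sup>2 + (\<Sum>t = 1..<T. (norm (?w t))\<^sup>2)) + c2 * ?E"
      using mpc_regret_le[of W ?w ?wp x1] unfolding rho gam E c1_def c2_def .
    also have "\<dots> \<le> c1 * ?S\<^sup>2 * ((norm x1)\<^sup>2 + ?D)
        + c2 * (1 / (1 - rho) + gam ^ W / (1 - rho\<^sup>2)) * (1 + gam ^ W / (1 - rho)) * ?E"
    proof (intro add_mono mult_left_mono mult_right_mono)
      show "(\<Sum>t = 1..<T. (norm (?w t))\<^sup>2) \<le> ?D"
        by (intro sum_mono2) auto
      show "0 \<le> c1 * ?S\<^sup>2"
        using \<alpha>1_nonneg by (simp add: c1_def)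
      have "1 \<le> 1 / (1 - rho) + gam ^ W / (1 - rho\<^sup>2)"
      proof -
        have "rho\<^sup>2 \<le> 1" using bounds by (intro power_le_one) auto
        then have "0 \<le> gam ^ W / (1 - rho\<^sup>2)" using bounds by simp
        moreover have "1 \<le> 1 / (1 - rho)" using bounds by simp
        ultimately show ?thesis by linarith
      qed
      moreover have "1 \<le> 1 + gam ^ W / (1 - rho)" using bounds by simp
      ultimately have "c2 * (1 * 1) \<le>
          c2 * ((1 / (1 - rho) + gam ^ W / (1 - rho\<^sup>2)) * (1 + gam ^ W / (1 - rho)))"
        using \<alpha>2_nonneg by (intro mult_left_mono mult_mono) (auto simp: c2_def)
      then show "c2 \<le> c2 * (1 / (1 - rho) + gam ^ W / (1 - rho\<^sup>2)) * (1 + gam ^ W / (1 - rho))"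
        by (simp add: mult.assoc)
    qed (use E_nonneg in auto)
    finally show ?thesis .
  qed
  then show ?thesis
    unfolding Let_def Pm_def[symmetric] rho_def[symmetric] gam_def[symmetric] by blast
qed

end
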